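(* Let $G(\lambda)=\left(-0.25\lambda+0.03\lambda^2+0.08\lambda^3\right)e^{-\lambda}$. Then $$R(k,\ell)\le e^{G(\ell/k)k+o(k)}\binom{k+\ell}{\ell}$$ for all positive integers $\ell\le k$; that is, there is a function $h:\mathbb{N}\to\mathbb{R}$ with $h(k)/k\to 0$ as $k\to\infty$ such that $R(k,\ell)\le e^{G(\ell/k)k+h(k)}\binom{k+\ell}{\ell}$ for all positive integers $\ell\le k$.
   Context: $R(k,\ell)$ denotes the two-color Ramsey number: the smallest positive integer $N$ such that every red-blue coloring of the edges of the complete graph $K_N$ contains a complete subgraph on $k$ vertices with all edges red or a complete subgraph on $\ell$ vertices with all edges blue. *)

theory Defs
  imports Complex_Main "HOL-Library.Ramsey"
begin

text \<open>
  Every map from the 2-element subsets of \<open>{..<N}\<close> (the edges of the complete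
  graph on \<open>N\<close> vertices) to the colours 0 (red) and 1 (blue) has a set of \<open>k\<close> vertices
  with all edges of colour 0 or a set of \<open>l\<close> vertices with all edges of colour 1:
  this is \<open>partn_lst {..<N} [k, l] 2\<close>.
\<close>

definition ramsey_number :: "nat \<Rightarrow> nat \<Rightarrow> nat" where
  "ramsey_number k l = (LEAST N. 0 < N \<and> partn_lst {..<N} [k, l] 2)"

lemma ramsey_number_works:
  "0 < ramsey_number k l \<and> partn_lst {..<ramsey_number k l} [k, l] 2"
proof -
  obtain N :: nat where "partn_lst {..<N} [k, l] 2"
    using ramsey_full by blast
  then have "partn_lst {..<Suc N} [k, l] 2"
    by (rule partn_lst_greater_resource) auto
  then have "0 < Suc N \<and> partn_lst {..<Suc N} [k, l] 2"
    by simp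
  then show ?thesis
    unfolding ramsey_number_def by (rule LeastI)
qed

definition G :: "real \<Rightarrow> real" where
  "G x = (- 0.25 * x + 0.03 * x^2 + 0.08 * x^3) * exp (- x)"

end

theory Submission
  imports Defs "HOL-Analysis.Analysis"
begin

text \<open>
  Write \<open>F x = G x + (1 + x) ln (1 + x) - x ln x\<close>, so that up to a polynomial factor the claim is
  \<open>R(k,l) \<le> exp (k F(l/k) + o(k))\<close>; this is proved by induction on \<open>k + l\<close>.
  Consider a colouring of \<open>N\<close> vertices without the two cliques. A vertex has fewer than
  \<open>R(k, l - 1)\<close> blue neighbours, so by induction and the concavity of \<open>F\<close> the red density is at
  least a certain \<open>p\<close>. Starting from the pair \<open>X = Y =\<close> all vertices, vertices are moved one
  after the other from \<open>X\<close> into a red clique that is joined in red to the new \<open>X\<close> and \<open>Y\<close>,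
  or into a blue clique that is joined in blue to \<open>X\<close>, while \<open>Y\<close> shrinks to the red
  neighbourhood of the vertex. The potential \<open>|X| |Y| q^c\<close>, with \<open>p + q\<close> the red
  density between \<open>X\<close> and \<open>Y\<close> and \<open>c\<close> a large constant, loses at most a factor \<open>exp (- a)\<close>
  in a red step and \<open>M\<close> in a blue step, where \<open>exp (- a) = (1 - M) p^(1/(1-M))\<close>; many vertices of blue
  degree above \<open>M |X|\<close> allow several blue steps at once. When \<open>X\<close> is exhausted, \<open>Y\<close> is so
  large that the induction hypothesis for the remaining red clique applies. What remains is a
  numerical inequality for each \<open>x = l/k\<close>, with suitable \<open>p, M, a, b\<close>. By the concavity
  of \<open>F\<close>, constant parameters on an interval only have to be checked at its end points, and
  finitely many intervals suffice.
\<close>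

section \<open>Cliques and Ramsey numbers\<close>

text \<open>A red step costs a factor exp (- a) of the potential, and with k' red vertices still to
  find, Y must have about exp (a k' + b l) vertices. As the same a occurs in both, the starting
  value, about N^2, has to exceed exp (a k + b l) M^(- l) whenever X happens to run out. For N about
  exp (k F(x)), x = l/k, this is a + x (b - ln M) \<le> 2 F(x). The formula for exp (- a) is a limit
  for large c: the relative gains in q are averaged with weights 1 - M and M, and the mean of c-th
  roots tends to a geometric mean. The obstacle is that errors must not accumulate in the induction.
  With the bound exp (k F(x) + e k + C) for N, the factor N^2 brings 2 e k + 2 C, while the
  induction hypothesis for Y consumes e k + C only once. The second copy of e k pays for everything
  of lower order. In the estimate of the red density the errors cancel, since N and the bound for
  R(k, l - 1) carry the same e k + C.\<close>

definition has_clique :: "('a \<Rightarrow> 'a \<Rightarrow> bool) \<Rightarrow> 'a set \<Rightarrow> nat \<Rightarrow> bool" where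
  "has_clique R V k \<longleftrightarrow> (\<exists>A\<subseteq>V. finite A \<and> card A = k \<and> pairwise R A)"

abbreviation blue :: "('a \<Rightarrow> 'a \<Rightarrow> bool) \<Rightarrow> 'a \<Rightarrow> 'a \<Rightarrow> bool" where
  "blue E \<equiv> \<lambda>u v. \<not> E u v"

lemma has_clique_0 [simp]: "has_clique R V 0"
  unfolding has_clique_def by (auto intro: exI[of _ "{}"])

lemma has_clique_mono: "has_clique R V k \<Longrightarrow> V \<subseteq> W \<Longrightarrow> has_clique R W k"
  unfolding has_clique_def by blast

lemma has_clique_le:
  assumes "has_clique R V k" "j \<le> k"
  shows "has_clique R V j"
proof -
  obtain A where A: "A \<subseteq> V" "finite A" "card A = k" "pairwise R A"
    using assms(1) unfolding has_clique_def by blast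
  obtain B where B: "B \<subseteq> A" "card B = j"
    using A assms(2) by (metis obtain_subset_with_card_n)
  then have "finite B" "pairwise R B"
    using A finite_subset pairwise_subset by blast+
  with A B show ?thesis unfolding has_clique_def by blast
qed

lemma has_clique_union:
  assumes "has_clique R V k" "finite B" "pairwise R B" "V \<inter> B = {}"
    and "\<And>u v. u \<in> V \<Longrightarrow> v \<in> B \<Longrightarrow> R u v \<and> R v u"
  shows "has_clique R (V \<union> B) (k + card B)"
proof -
  obtain A where A: "A \<subseteq> V" "finite A" "card A = k" "pairwise R A"
    using assms(1) unfolding has_clique_def by blast
  have "pairwise R (A \<union> B)"
    using A assms unfolding pairwise_def by blast
  moreover have "card (A \<union> B) = k + card B"
    using A assms by (subst card_Un_disjoint) auto
  ultimately show ?thesis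
    unfolding has_clique_def using A assms by (intro exI[of _ "A \<union> B"]) auto
qed

lemma has_clique_insert:
  assumes "has_clique R V k" "v \<notin> V" "\<And>u. u \<in> V \<Longrightarrow> R u v \<and> R v u"
  shows "has_clique R (insert v V) (Suc k)"
  using has_clique_union[OF assms(1), of "{v}"] assms by (simp add: pairwise_def)

lemma ramsey_number_pos: "0 < ramsey_number k l"
  using ramsey_number_works by blast

text \<open>Together with \<open>ramsey_number_le\<close> this replaces edge colourings by symmetric
  relations, red meaning \<open>E\<close>, and frees the argument from the vertex set
  \<open>{..<N}\<close>.\<close>

lemma ramsey_number_cliques:
  fixes V :: "'a set"
  assumes "finite V" "ramsey_number k l \<le> card V" "symp E"
  shows "has_clique E V k \<or> has_clique (blue E) V l"
proof -
  let ?n = "card V"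
  obtain g where g: "bij_betw g {..<?n} V"
    using ex_bij_betw_nat_finite[OF assms(1)] by (auto simp: atLeast0LessThan)
  define f where "f e = (if \<exists>u v. e = {u,v} \<and> E (g u) (g v) then 0 else 1::nat)" for e
  have fE: "f {u,v} = 0 \<longleftrightarrow> E (g u) (g v)" for u v
    using \<open>symp E\<close> by (auto simp: f_def doubleton_eq_iff dest: sympD)
  have f1: "f {u,v} = 1 \<longleftrightarrow> \<not> E (g u) (g v)" for u v
    using fE[of u v] by (auto simp: f_def split: if_splits)
  have "partn_lst {..<?n} [k, l] 2"
    using partn_lst_greater_resource[OF _ assms(2)] ramsey_number_works by blast
  moreover have "f \<in> nsets {..<?n} 2 \<rightarrow> {..<length [k,l]}"
    by (auto simp: f_def)
  ultimately have "\<exists>i<length [k,l]. monochromatic {..<?n} ([k,l]!i) 2 f i"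
    unfolding partn_lst_def by blast
  then obtain i H where i: "i < 2" and H: "H \<in> nsets {..<?n} ([k,l]!i)" "f ` nsets H 2 \<subseteq> {i}"
    unfolding monochromatic_def by (metis length_Cons list.size(3) numeral_2_eq_2)
  have gH: "g ` H \<subseteq> V" "inj_on g H"
    using H(1) g by (auto simp: nsets_def bij_betw_def inj_on_subset)
  have fin: "finite (g ` H)" "card (g ` H) = [k,l]!i"
    using H(1) gH by (auto simp: nsets_def card_image)
  have fi: "f {u,v} = i" if "u \<in> H" "v \<in> H" "u \<noteq> v" for u v
    using H(2) that by (auto simp: image_subset_iff)
  consider "i = 0" | "i = 1" using i by linarith
  then show ?thesis
  proof cases
    case 1
    then have "pairwise E (g ` H)"
      using fi fE unfolding pairwise_def by blast
    then show ?thesis using 1 fin gH unfolding has_clique_def by auto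
  next
    case 2
    then have "pairwise (blue E) (g ` H)"
      using fi f1 unfolding pairwise_def by blast
    then show ?thesis using 2 fin gH unfolding has_clique_def by auto
  qed
qed

lemma ramsey_number_le:
  assumes "0 < N"
    and "\<And>E :: nat \<Rightarrow> nat \<Rightarrow> bool. symp E \<Longrightarrow> irreflp E \<Longrightarrow>
           has_clique E {..<N} k \<or> has_clique (blue E) {..<N} l"
  shows "ramsey_number k l \<le> N"
proof -
  have "\<exists>i<2. monochromatic {..<N} ([k,l]!i) 2 f i"
    if f: "f \<in> nsets {..<N} 2 \<rightarrow> {..<2}" for f
  proof -
    define E where "E u v \<longleftrightarrow> u \<noteq> v \<and> f {u,v} = 0" for u v :: nat
    have "symp E" "irreflp E"
      by (auto simp: E_def symp_def irreflp_def insert_commute)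
    from assms(2)[OF this] show ?thesis
    proof
      assume "has_clique E {..<N} k"
      then obtain A where A: "A \<subseteq> {..<N}" "finite A" "card A = k" "pairwise E A"
        unfolding has_clique_def by blast
      have "f ` nsets A 2 \<subseteq> {0}"
        using A(4) by (auto simp: E_def pairwise_def elim!: nsets2_E)
      then have "monochromatic {..<N} k 2 f 0"
        unfolding monochromatic_def using A by (auto simp: nsets_def)
      then show ?thesis by (intro exI[of _ 0]) auto
    next
      assume "has_clique (blue E) {..<N} l"
      then obtain A where A: "A \<subseteq> {..<N}" "finite A" "card A = l" "pairwise (blue E) A"
        unfolding has_clique_def by blast
      have "f {u,v} = 1" if "u \<in> A" "v \<in> A" "u \<noteq> v" for u v
      proof -
        have "f {u,v} \<noteq> 0" using A(4) that by (auto simp: E_def pairwise_def)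
        moreover have "f {u,v} \<in> {..<2}" using f that A(1) by (intro Pi_mem[OF f]) auto
        ultimately show ?thesis by auto
      qed
      then have "f ` nsets A 2 \<subseteq> {1}"
        by (auto elim!: nsets2_E)
      then have "monochromatic {..<N} l 2 f 1"
        unfolding monochromatic_def using A by (auto simp: nsets_def)
      then show ?thesis by (intro exI[of _ 1]) auto
    qed
  qed
  then have "partn_lst {..<N} [k,l] 2"
    unfolding partn_lst_def by (simp add: numeral_2_eq_2)
  then show ?thesis
    unfolding ramsey_number_def using assms(1) by (intro Least_le) simp
qed

text \<open>Empty cliques always exist; the value is 1 because the definition asks for a positive
  N.\<close>

lemma ramsey_number_0 [simp]: "ramsey_number 0 l = 1" "ramsey_number k 0 = 1"
  using ramsey_number_pos[of 0 l] ramsey_number_pos[of k 0]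
    ramsey_number_le[of 1 0 l] ramsey_number_le[of 1 k 0] by fastforce+

lemma ramsey_number_commute_le: "ramsey_number k l \<le> ramsey_number l k"
proof (rule ramsey_number_le[OF ramsey_number_pos])
  fix E :: "nat \<Rightarrow> nat \<Rightarrow> bool" assume E: "symp E" "irreflp E"
  have "symp (blue E)" using E(1) by (auto simp: symp_def)
  from ramsey_number_cliques[OF _ _ this, of "{..<ramsey_number l k}" l k]
  show "has_clique E {..<ramsey_number l k} k \<or> has_clique (blue E) {..<ramsey_number l k} l"
    by auto
qed

lemma ramsey_number_commute: "ramsey_number k l = ramsey_number l k"
  by (simp add: ramsey_number_commute_le antisym)

lemma ramsey_number_rec:
  assumes "0 < k" "0 < l"
  shows "ramsey_number k l \<le> ramsey_number (k-1) l + ramsey_number k (l-1)"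
proof -
  let ?a = "ramsey_number (k-1) l" and ?b = "ramsey_number k (l-1)"
  have "partn_lst {..<Suc (?a + ?b - 1)} [k, l] (Suc 1)"
    using ramsey_number_works assms ramsey1_explicit[of ?a ?b]
    by (intro ramsey_induction_step[of ?a k l 1 ?b]) (auto simp: numeral_2_eq_2)
  moreover have "Suc (?a + ?b - 1) = ?a + ?b"
    using ramsey_number_pos[of "k-1" l] by simp
  ultimately have "partn_lst {..<?a + ?b} [k, l] 2"
    by (simp add: numeral_2_eq_2)
  then show ?thesis
    unfolding ramsey_number_def[of k l]
    using ramsey_number_pos[of "k-1" l] by (intro Least_le) simp
qed

lemma ramsey_number_le_choose: "ramsey_number k l \<le> (k + l) choose l"
proof (induction "k + l" arbitrary: k l)
  case 0
  then show ?case by simp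
next
  case (Suc n)
  show ?case
  proof (cases "k = 0 \<or> l = 0")
    case True
    then show ?thesis by auto
  next
    case False
    then have kl: "0 < k" "0 < l" by auto
    have "ramsey_number k l \<le> ramsey_number (k-1) l + ramsey_number k (l-1)"
      by (rule ramsey_number_rec[OF kl])
    also have "\<dots> \<le> ((k - 1 + l) choose l) + ((k + (l - 1)) choose (l - 1))"
      using Suc.hyps(2) kl by (intro add_mono Suc.hyps(1)) auto
    also have "\<dots> = (k + l) choose l"
      using kl choose_reduce_nat[of "k+l" l] by (simp add: add.commute)
    finally show ?thesis .
  qed
qed

section \<open>The book lemma\<close>

text \<open>The condition \<open>u \<noteq> v\<close> matters for \<open>blue E\<close>, which holds
  on the diagonal when \<open>E\<close> is irreflexive.\<close>

definition nbh :: "('a \<Rightarrow> 'a \<Rightarrow> bool) \<Rightarrow> 'a \<Rightarrow> 'a set \<Rightarrow> 'a set" where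
  "nbh R v X = {u \<in> X. u \<noteq> v \<and> R v u}"

definition excess :: "('a \<Rightarrow> 'a \<Rightarrow> bool) \<Rightarrow> real \<Rightarrow> 'a set \<Rightarrow> 'a set \<Rightarrow> real" where
  "excess E p X Y = (\<Sum>x\<in>X. real (card (nbh E x Y)) - p * real (card Y))"

text \<open>This is the q of the overview: the red density between X and Y is p plus this number.
  For empty X or Y division by zero gives 0, in agreement with the excess.\<close>

definition rel_excess :: "('a \<Rightarrow> 'a \<Rightarrow> bool) \<Rightarrow> real \<Rightarrow> 'a set \<Rightarrow> 'a set \<Rightarrow> real" where
  "rel_excess E p X Y = excess E p X Y / (real (card X) * real (card Y))"

lemma nbh_subset: "nbh R v X \<subseteq> X"
  by (auto simp: nbh_def)

lemma finite_nbh [simp]: "finite X \<Longrightarrow> finite (nbh R v X)"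
  by (simp add: nbh_def)

lemma card_nbh_le: "finite X \<Longrightarrow> card (nbh R v X) \<le> card X"
  by (simp add: card_mono nbh_subset)

lemma notin_nbh [simp]: "v \<notin> nbh R v X"
  by (simp add: nbh_def)

lemma excess_eq_rel_excess:
  assumes "finite X" "finite Y"
  shows "excess E p X Y = rel_excess E p X Y * (real (card X) * real (card Y))"
proof (cases "X = {} \<or> Y = {}")
  case True
  then show ?thesis
    by (auto simp: excess_def rel_excess_def nbh_def)
next
  case False
  then show ?thesis
    using assms by (simp add: rel_excess_def)
qed

lemma excess_Un:
  assumes "finite X" "finite X'" "X \<inter> X' = {}"
  shows "excess E p (X \<union> X') Y = excess E p X Y + excess E p X' Y"
  unfolding excess_def using assms by (rule sum.union_disjoint)

lemma excess_le:
  assumes "finite X" "finite Y" "0 \<le> p"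
  shows "excess E p X Y \<le> (1 - p) * (real (card X) * real (card Y))"
proof -
  have "real (card (nbh E x Y)) - p * real (card Y) \<le> (1 - p) * real (card Y)" for x
    using card_nbh_le[OF assms(2), of E x] by (simp add: algebra_simps)
  then have "excess E p X Y \<le> (\<Sum>x\<in>X. (1 - p) * real (card Y))"
    unfolding excess_def by (intro sum_mono)
  also have "\<dots> = (1 - p) * (real (card X) * real (card Y))"
    by simp
  finally show ?thesis .
qed

lemma rel_excess_le:
  assumes "finite X" "finite Y" "0 \<le> p" "0 < excess E p X Y"
  shows "rel_excess E p X Y \<le> 1 - p"
proof -
  have "X \<noteq> {}" "Y \<noteq> {}" using assms(4) by (auto simp: excess_def nbh_def)
  then have "0 < real (card X) * real (card Y)" using assms by (simp add: card_gt_0_iff)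
  then show ?thesis
    using excess_le[OF assms(1-3), of E] unfolding rel_excess_def by (subst pos_divide_le_eq) auto
qed

lemma card_nbh_sum:
  assumes "finite Y" "irreflp E"
  shows "real (card (nbh E x Y)) = (\<Sum>y\<in>Y. of_bool (E x y))"
proof -
  have "nbh E x Y = {y\<in>Y. E x y}"
    using assms(2) by (auto simp: nbh_def irreflp_def)
  moreover have "Y \<inter> {y. E x y} = {y\<in>Y. E x y}" by blast
  ultimately show ?thesis using assms(1) by simp
qed

(* Convexity (Cauchy-Schwarz) in the X-degrees of the vertices of Y. *)
lemma excess_average:
  assumes fin: "finite X" "finite Y" and E: "symp E" "irreflp E" and p: "0 \<le> p"
  shows "0 \<le> (\<Sum>v\<in>X. excess E p X (nbh E v Y)
                - rel_excess E p X Y * real (card X) * real (card (nbh E v Y)))"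
proof (cases "Y = {} \<or> X = {}")
  case True
  then show ?thesis by (auto simp: excess_def nbh_def)
next
  case False
  define n y where "n = real (card X)" and "y = real (card Y)"
  have ny: "0 < n" "0 < y" using False fin by (auto simp: n_def y_def card_gt_0_iff)
  define q where "q = rel_excess E p X Y"
  define e where "e u v = (of_bool (E u v) :: real)" for u v
  define d where "d u = (\<Sum>x\<in>X. e x u)" for u
  define T where "T = (\<Sum>u\<in>Y. d u)"
  have cn: "real (card (nbh E v Y)) = (\<Sum>u\<in>Y. e v u)" for v
    using card_nbh_sum[OF fin(2) E(2)] by (simp add: e_def)
  have T: "(\<Sum>v\<in>X. real (card (nbh E v Y))) = T"
    unfolding cn T_def d_def by (rule sum.swap)
  have exY: "excess E p X Y = T - p * n * y"
    unfolding excess_def sum_subtractf T by (simp add: n_def y_def)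
  have qT: "q * (n * y) = T - p * n * y"
    using exY excess_eq_rel_excess[OF fin, of E p] by (simp add: q_def n_def y_def)
  have cc: "real (card (nbh E x (nbh E v Y))) = (\<Sum>u\<in>Y. e v u * e x u)" for x v
  proof -
    have "nbh E x (nbh E v Y) = {u\<in>Y. E v u \<and> E x u}"
      using E(2) by (auto simp: nbh_def irreflp_def)
    moreover have "Y \<inter> {u. E v u \<and> E x u} = {u\<in>Y. E v u \<and> E x u}" by blast
    ultimately show ?thesis using fin
      by (simp add: e_def flip: of_bool_conj)
  qed
  have "(\<Sum>v\<in>X. excess E p X (nbh E v Y))
      = (\<Sum>v\<in>X. \<Sum>x\<in>X. \<Sum>u\<in>Y. e v u * e x u) - p * n * T"
    unfolding excess_def sum_subtractf cc
    by (simp add: n_def flip: sum_distrib_left T)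
  \<comment> \<open>Red paths v - u - x are counted by their middle vertex u in Y.\<close>
  also have "(\<Sum>v\<in>X. \<Sum>x\<in>X. \<Sum>u\<in>Y. e v u * e x u) = (\<Sum>u\<in>Y. (d u)\<^sup>2)"
  proof -
    have "(\<Sum>v\<in>X. \<Sum>x\<in>X. \<Sum>u\<in>Y. e v u * e x u) = (\<Sum>v\<in>X. \<Sum>u\<in>Y. e v u * d u)"
      unfolding d_def sum_distrib_left by (intro sum.cong refl sum.swap)
    also have "\<dots> = (\<Sum>u\<in>Y. \<Sum>v\<in>X. e v u * d u)" by (rule sum.swap)
    also have "\<dots> = (\<Sum>u\<in>Y. (d u)\<^sup>2)"
      unfolding d_def power2_eq_square sum_distrib_right by simp
    finally show ?thesis .
  qed
  finally have 1: "(\<Sum>v\<in>X. excess E p X (nbh E v Y)) = (\<Sum>u\<in>Y. (d u)\<^sup>2) - p * n * T" .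
  have cs: "T\<^sup>2 \<le> (\<Sum>u\<in>Y. (d u)\<^sup>2) * y"
    using Cauchy_Schwarz_ineq_sum[of d "\<lambda>_. 1" Y] by (simp add: T_def y_def)
  \<comment> \<open>The mean X-degree of a vertex of Y is (p + q) n, so the Cauchy-Schwarz bound T^2
    / y equals (p + q) n T.\<close>
  have Ty: "T = (p * n + q * n) * y" using qT by (simp add: algebra_simps)
  have "((p * n + q * n) * T) * y \<le> (\<Sum>u\<in>Y. (d u)\<^sup>2) * y"
    using cs Ty by (simp add: power2_eq_square mult_ac)
  then have "(p * n + q * n) * T \<le> (\<Sum>u\<in>Y. (d u)\<^sup>2)"
    using ny by simp
  then have "0 \<le> (\<Sum>u\<in>Y. (d u)\<^sup>2) - p * n * T - q * n * T"
    by (simp add: algebra_simps)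
  also have "\<dots> = (\<Sum>v\<in>X. excess E p X (nbh E v Y) - q * n * real (card (nbh E v Y)))"
    unfolding sum_subtractf 1 by (simp flip: sum_distrib_left T)
  finally show ?thesis by (simp add: q_def n_def)
qed

(* Bernoulli's inequality for the c-th power of the ratio of the relative excesses. *)
lemma delete_vertex:
  assumes fin: "finite X" "finite Y" and v: "v \<in> X" and pos: "0 < excess E p X Y"
    and low: "rel_excess E p X Y * real (card Y)
        \<le> real c * (rel_excess E p X Y * real (card Y) - (real (card (nbh E v Y)) - p * real (card Y)))"
  shows "0 < excess E p (X - {v}) Y"
    and "real (card X) * rel_excess E p X Y ^ c
          \<le> real (card (X - {v})) * rel_excess E p (X - {v}) Y ^ c"
proof -
  define q where "q = rel_excess E p X Y"
  define g where "g = real (card (nbh E v Y)) - p * real (card Y)"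
  define n y where "n = real (card X)" and "y = real (card Y)"
  have "Y \<noteq> {}" using pos by (auto simp: excess_def nbh_def)
  then have y: "0 < y" using fin by (simp add: y_def card_gt_0_iff)
  have n0: "0 < n" using v fin by (auto simp: n_def card_gt_0_iff)
  have exq: "excess E p X Y = q * (n * y)"
    using excess_eq_rel_excess[OF fin] by (simp add: q_def n_def y_def)
  have q: "0 < q" using pos exq y n0 by (metis mult_pos_pos zero_less_mult_pos2)
  have ex': "excess E p (X - {v}) Y = q * (n * y) - g"
    using sum.remove[OF fin(1) v, of "\<lambda>x. real (card (nbh E x Y)) - p * real (card Y)"] exq
    by (simp add: excess_def g_def)
  have low': "q * y \<le> real c * (q * y - g)"
    using low by (simp add: q_def g_def y_def)
  have c: "0 < c" using low' q y by (cases c) (auto simp: mult_le_0_iff)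
  have gl: "g < q * y"
    using low' q y c by (smt (verit) mult_pos_pos of_nat_0_less_iff zero_less_mult_pos)
  have card': "card X = Suc (card (X - {v}))"
    using v fin by (metis card_Suc_Diff1)
  have n1: "n - 1 = real (card (X - {v}))" using card' by (simp add: n_def)
  have "X \<noteq> {v}"
  proof
    assume "X = {v}"
    then have "q * y - g = 0" using ex' by (simp add: excess_def n_def)
    then have "q * y \<le> 0" using low' by simp
    then show False using q y by (simp add: mult_le_0_iff)
  qed
  then have "X - {v} \<noteq> {}" using v by blast
  then have "0 < card (X - {v})" using fin by (metis card_gt_0_iff finite_Diff)
  then have n2: "0 < n - 1" unfolding n1 by linarith
  show pos': "0 < excess E p (X - {v}) Y"
  proof -
    have "q * y \<le> q * (n * y)"
      using n2 q y by (simp add: mult_left_mono)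
    then show ?thesis using ex' gl by simp
  qed
  define q' where "q' = rel_excess E p (X - {v}) Y"
  have q'eq: "q' = (q * (n * y) - g) / ((n - 1) * y)"
    unfolding q'_def rel_excess_def ex' by (simp add: n1 y_def)
  \<comment> \<open>The relative gain in q. The assumption on v says that c t is at least 1/(n - 1),
    which makes up for the factor (n - 1)/n lost in |X|.\<close>
  define t where "t = (q * y - g) / (q * y * (n - 1))"
  have t0: "0 \<le> t" unfolding t_def using gl q y n2 by simp
  have q't: "q' = q * (1 + t)"
    unfolding q'eq t_def using q y n2 by (simp add: field_simps)
  have ct: "1 / (n - 1) \<le> real c * t"
  proof -
    have "1 / (n - 1) = q * y / (q * y * (n - 1))" using q y by simp
    also have "\<dots> \<le> real c * (q * y - g) / (q * y * (n - 1))"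
      using low' q y n2 by (intro divide_right_mono) auto
    finally show ?thesis by (simp add: t_def)
  qed
  have "1 + real c * t \<le> (1 + t) ^ c"
    using t0 by (intro Bernoulli_inequality) auto
  moreover have "n / (n - 1) = 1 + 1 / (n - 1)" using n2 by (simp add: field_simps)
  ultimately have "n / (n - 1) \<le> (1 + t) ^ c" using ct by linarith
  then have "n \<le> (n - 1) * (1 + t) ^ c"
    using n2 by (simp add: pos_divide_le_eq mult.commute)
  then have "q ^ c * n \<le> q ^ c * ((n - 1) * (1 + t) ^ c)"
    using q by (intro mult_left_mono) auto
  then have "n * q ^ c \<le> (n - 1) * (q ^ c * (1 + t) ^ c)"
    by (simp add: mult_ac)
  also have "\<dots> = (n - 1) * q' ^ c" by (simp add: q't power_mult_distrib)
  finally show "real (card X) * rel_excess E p X Y ^ c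
          \<le> real (card (X - {v})) * rel_excess E p (X - {v}) Y ^ c"
    unfolding n1 unfolding q_def q'_def n_def .
qed

(* If neither a red nor a blue step keeps up the potential, both relative excesses are
   bounded (tangent inequality t <= 1 + (t^c - 1)/c), contradicting their weighted mean. *)
lemma red_or_blue_step:
  fixes r \<beta> \<rho> \<sigma> p M \<alpha> \<gamma> x z \<eta> :: real and c :: nat
  assumes pM: "0 < p" "0 < M" "M < 1" and c: "0 < c"
    and ag: "0 < \<alpha>" "\<alpha> \<le> \<gamma>"
    and lt: "(1 - M) * \<alpha> + M * \<gamma> < 1 - \<eta>"
    and x: "x / p \<le> \<alpha> ^ c * (1 - M)" "0 \<le> x" and z: "z \<le> M" "0 \<le> z" "1 / p \<le> \<gamma> ^ c"
    and r: "0 \<le> r" "0 \<le> \<beta>" "r + \<beta> \<le> 1" "\<beta> \<le> M"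
    and mean: "1 - \<eta> \<le> r * \<rho> + \<beta> * \<sigma>"
  shows "(0 < \<rho> \<and> x \<le> r * p * \<rho> ^ c) \<or> (0 < \<sigma> \<and> z \<le> \<beta> * p * \<sigma> ^ c)"
proof (rule ccontr)
  assume neg: "\<not> ?thesis"
  \<comment> \<open>The tangent inequality at \<open>\<tau> = a\<close>: a bound on the c-th power
    becomes a linear bound, nearly \<open>a * R\<close> when c is large.\<close>
  have key: "R * \<tau> \<le> a * ((1 - 1 / real c) * R + B / real c)"
    if R: "0 \<le> R" and a: "0 < a" and B: "0 \<le> B" and h: "0 < \<tau> \<Longrightarrow> R * \<tau> ^ c \<le> a ^ c * B" for R \<tau> a B :: real
  proof (cases "0 < \<tau>")
    case True
    define t where "t = \<tau> / a"
    have t: "0 < t" "\<tau> = a * t" using True a by (auto simp: t_def)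
    have "R * (a ^ c * t ^ c) \<le> a ^ c * B" using h[OF True] t by (simp add: power_mult_distrib)
    then have Rt: "R * t ^ c \<le> B" using a by (simp add: mult.left_commute)
    have "1 + real c * (t - 1) \<le> t ^ c"
      using Bernoulli_inequality[of "t - 1" c] t by simp
    then have "R * (1 + real c * (t - 1)) \<le> B"
      using Rt R by (meson mult_left_mono order_trans)
    then have "R * t \<le> (1 - 1 / real c) * R + B / real c"
      using c by (simp add: field_simps)
    then show ?thesis using t a by (simp add: mult.left_commute)
  next
    case False
    then have "R * \<tau> \<le> 0" using R by (simp add: mult_nonneg_nonpos)
    moreover have "0 \<le> a * ((1 - 1 / real c) * R + B / real c)"
      using R a B c by (auto intro!: mult_nonneg_nonneg add_nonneg_nonneg)
    ultimately show ?thesis by linarith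
  qed
  define s where "s = 1 / real c"
  have s: "0 < s" "s \<le> 1" using c by (auto simp: s_def)
  have "r * \<rho> \<le> \<alpha> * ((1 - s) * r + s * (1 - M))"
  proof -
    have "r * \<rho> ^ c \<le> \<alpha> ^ c * (1 - M)" if "0 < \<rho>"
    proof -
      have "r * p * \<rho> ^ c < x" using neg that by auto
      then have "r * \<rho> ^ c < x / p" using pM by (simp add: field_simps)
      then show ?thesis using x by simp
    qed
    from key[OF r(1) ag(1) _ this] pM show ?thesis by (simp add: s_def)
  qed
  moreover have "\<beta> * \<sigma> \<le> \<gamma> * ((1 - s) * \<beta> + s * M)"
  proof -
    have "\<beta> * \<sigma> ^ c \<le> \<gamma> ^ c * M" if "0 < \<sigma>"
    proof -
      have "\<beta> * p * \<sigma> ^ c < M" using neg that z by auto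
      then have "\<beta> * \<sigma> ^ c < (1 / p) * M" using pM by (simp add: field_simps)
      also have "\<dots> \<le> \<gamma> ^ c * M" using z pM by (intro mult_right_mono) auto
      finally show ?thesis by simp
    qed
    from key[OF r(2) _ _ this] ag pM show ?thesis by (simp add: s_def)
  qed
  moreover have "\<alpha> * ((1 - s) * r + s * (1 - M)) \<le> \<alpha> * ((1 - s) * (1 - \<beta>) + s * (1 - M))"
    using ag s r by (intro mult_left_mono add_right_mono) auto
  \<comment> \<open>As \<open>\<alpha> \<le> \<gamma>\<close>, the worst case is \<beta> = M; there
    the bound is the weighted mean that is assumed to be below \<open>1 - \<eta>\<close>.\<close>
  moreover have "\<alpha> * ((1 - s) * (1 - \<beta>) + s * (1 - M)) + \<gamma> * ((1 - s) * \<beta> + s * M)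
      = (1 - M) * \<alpha> + M * \<gamma> - (\<gamma> - \<alpha>) * (1 - s) * (M - \<beta>)"
    by (simp add: algebra_simps)
  moreover have "0 \<le> (\<gamma> - \<alpha>) * (1 - s) * (M - \<beta>)"
    using ag s r by simp
  ultimately show False using mean lt by linarith
qed

section \<open>Many vertices of large degree have a large common neighbourhood\<close>

lemma power_mean_lower:
  fixes f :: "'a \<Rightarrow> real"
  assumes "finite X" "\<And>u. u \<in> X \<Longrightarrow> 0 \<le> f u" "0 \<le> t" "t * real (card X) \<le> sum f X"
  shows "t ^ b * real (card X) \<le> (\<Sum>u\<in>X. f u ^ b)"
proof (cases "t = 0 \<or> b = 0")
  case True
  then show ?thesis
    using assms(2) by (cases "b = 0") (auto intro!: sum_nonneg simp: power_0_left)
next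
  case False
  then have t: "0 < t" using assms(3) by simp
  have tan: "t ^ b + real b * t ^ (b - 1) * (f u - t) \<le> f u ^ b" if "u \<in> X" for u
  proof -
    have "1 + real b * (f u / t - 1) \<le> (f u / t) ^ b"
      using Bernoulli_inequality[of "f u / t - 1" b] assms(2)[OF that] t by simp
    then have "t ^ b * (1 + real b * (f u / t - 1)) \<le> t ^ b * (f u / t) ^ b"
      using t by (intro mult_left_mono) auto
    moreover have "t ^ b * (1 + real b * (f u / t - 1)) = t ^ b + real b * t ^ (b - 1) * (f u - t)"
    proof -
      have "t ^ b = t ^ (b - 1) * t" using False by (simp add: power_eq_if)
      moreover have "t * (1 + real b * (f u / t - 1)) = t + real b * (f u - t)"
        using t by (simp add: algebra_simps)
      ultimately show ?thesis using t by (simp add: algebra_simps)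
    qed
    moreover have "t ^ b * (f u / t) ^ b = f u ^ b" using t by (simp add: power_divide)
    ultimately show ?thesis by linarith
  qed
  \<comment> \<open>The sum of the tangents at t. Since t is only a lower bound for the mean, the
    nonnegative slope absorbs the difference.\<close>
  have "t ^ b * real (card X) \<le> t ^ b * real (card X) + real b * t ^ (b - 1) * (sum f X - t * real (card X))"
    using assms t by simp
  also have "\<dots> = (\<Sum>u\<in>X. t ^ b + real b * t ^ (b - 1) * (f u - t))"
    by (simp add: sum.distrib sum_subtractf flip: sum_distrib_left)
  also have "\<dots> \<le> (\<Sum>u\<in>X. f u ^ b)" by (intro sum_mono tan)
  finally show ?thesis .
qed

text \<open>Each factor of the falling factorial is at least d - b; truncated subtraction takes care
  of d < b.\<close>

lemma fact_choose_lower: "real (d - b) ^ b \<le> fact b * real (d choose b)"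
proof (cases "b \<le> d")
  case True
  have "(\<Prod>i=0..<b. real d - real b) \<le> (\<Prod>i=0..<b. real d - real i)"
    using True by (intro prod_mono) auto
  also have "\<dots> = fact b * real (d choose b)"
    by (simp add: binomial_gbinomial gbinomial_prod_rev)
  finally show ?thesis using True by (simp add: of_nat_diff)
qed (simp add: power_0_left)

lemma fact_choose_upper: "fact b * real (s choose b) \<le> real s ^ b"
proof -
  have "fact b * (s choose b) \<le> s ^ b"
    by (metis binomial_fact_pow mult.commute)
  then show ?thesis by (metis of_nat_fact of_nat_le_iff of_nat_mult of_nat_power)
qed

(* Double counting of pairs (B, u), with B a b-subset of S in the neighbourhood of u. *)
lemma common_neighbourhood:
  fixes R :: "'a \<Rightarrow> 'a \<Rightarrow> bool"
  assumes fin: "finite X" "finite S" and R: "symp R"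
    and deg: "\<And>v. v \<in> S \<Longrightarrow> M * real (card X) \<le> real (card (nbh R v X))"
    and M: "0 < M" "M < 1" and s: "2 * real b ^ 2 \<le> M * real (card S)" and b: "1 \<le> b"
  obtains B where "B \<subseteq> S" "card B = b"
    "M ^ b / 2 * real (card X) \<le> real (card {u\<in>X. \<forall>v\<in>B. u \<noteq> v \<and> R v u})"
proof -
  define s where "s = real (card S)"
  define n where "n = real (card X)"
  define D where "D u = {v\<in>S. u \<noteq> v \<and> R v u}" for u
  define N where "N B = {u\<in>X. \<forall>v\<in>B. u \<noteq> v \<and> R v u}" for B
  have finD: "finite (D u)" for u using fin by (simp add: D_def)
  have "0 < M * s" using assms(6) s b by (smt (verit) of_nat_1 of_nat_le_iff one_le_power s_def)
  then have s0: "0 < s" using M by (simp add: zero_less_mult_iff)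
  have bs: "real b \<le> M * s"
  proof -
    have "real b * 1 \<le> real b * real b" using b by (intro mult_left_mono) auto
    then show ?thesis using s by (simp add: s_def power2_eq_square)
  qed
  have bs': "b \<le> card S"
  proof -
    have "M * s \<le> 1 * s" using M s0 by (intro mult_right_mono) auto
    then show ?thesis using bs by (simp add: s_def)
  qed
  have "(\<Sum>u\<in>X. real (card (D u))) = (\<Sum>v\<in>S. real (card (nbh R v X)))"
  proof -
    have "(\<Sum>u\<in>X. card {v\<in>S. u \<noteq> v \<and> R v u}) = (\<Sum>v\<in>S. card {u\<in>X. u \<noteq> v \<and> R v u})"
      using fin by (rule sum_multicount_gen) auto
    then have "real (\<Sum>u\<in>X. card (D u)) = real (\<Sum>v\<in>S. card (nbh R v X))"
      by (simp only: D_def nbh_def)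
    then show ?thesis by simp
  qed
  also have "\<dots> \<ge> (\<Sum>v\<in>S. M * n)" using deg by (intro sum_mono) (auto simp: n_def)
  finally have sumD: "s * M * n \<le> (\<Sum>u\<in>X. real (card (D u)))"
    by (simp add: s_def mult.assoc)
  have "(\<Sum>u\<in>X. real (card (D u))) - real b * n \<le> (\<Sum>u\<in>X. real (card (D u) - b))"
  proof -
    have "(\<Sum>u\<in>X. real (card (D u))) - real b * n = (\<Sum>u\<in>X. real (card (D u)) - real b)"
      by (simp add: sum_subtractf n_def)
    also have "\<dots> \<le> (\<Sum>u\<in>X. real (card (D u) - b))" by (intro sum_mono) auto
    finally show ?thesis .
  qed
  then have mean: "(s * M - real b) * n \<le> (\<Sum>u\<in>X. real (card (D u) - b))"
    using sumD by (simp add: algebra_simps)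
  have "(s * M - real b) ^ b * n \<le> (\<Sum>u\<in>X. real (card (D u) - b) ^ b)"
    unfolding n_def using mean bs fin by (intro power_mean_lower) (auto simp: n_def mult.commute)
  also have "\<dots> \<le> (\<Sum>u\<in>X. fact b * real (card (D u) choose b))"
    by (intro sum_mono fact_choose_lower)
  also have "\<dots> = fact b * real (\<Sum>u\<in>X. card (nsets (D u) b))"
    by (simp flip: sum_distrib_left)
  also have "(\<Sum>u\<in>X. card (nsets (D u) b)) = (\<Sum>u\<in>X. card {B \<in> nsets S b. u \<in> N B})"
    by (intro sum.cong refl arg_cong[where f = card]) (auto simp: nsets_def D_def N_def)
  also have "\<dots> = (\<Sum>B\<in>nsets S b. card {u\<in>X. u \<in> N B})"
    using fin by (intro sum_multicount_gen) (auto simp: finite_imp_finite_nsets)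
  also have "\<dots> = (\<Sum>B\<in>nsets S b. card (N B))"
    by (intro sum.cong refl arg_cong[where f = card]) (auto simp: N_def)
  finally have tot: "(s * M - real b) ^ b * n \<le> fact b * real (\<Sum>B\<in>nsets S b. card (N B))" .
  have half: "M ^ b / 2 * s ^ b \<le> (s * M - real b) ^ b"
  proof -
    \<comment> \<open>Replacing degrees D by D - b costs the factor (1 - t)^b, which is at least 1 -
      b t; the condition 2 b^2 \<le> M s makes this at least 1/2.\<close>
    define t where "t = real b / (s * M)"
    have sM: "0 < s * M" using s0 M by simp
    have t: "t \<le> 1" "0 \<le> t" "real b * t \<le> 1 / 2"
      using bs sM s by (auto simp: t_def field_simps power2_eq_square s_def)
    have "1 + real b * (- t) \<le> (1 + (- t)) ^ b"
      using t by (intro Bernoulli_inequality) auto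
    then have "1 / 2 \<le> (1 - t) ^ b" using t by simp
    then have "(s * M) ^ b * (1 / 2) \<le> (s * M) ^ b * (1 - t) ^ b"
      using sM by (intro mult_left_mono) auto
    also have "\<dots> = (s * M - real b) ^ b"
      using s0 M by (simp add: t_def right_diff_distrib flip: power_mult_distrib)
    finally show ?thesis by (simp add: power_mult_distrib mult_ac)
  qed
  have "\<exists>B\<in>nsets S b. M ^ b / 2 * n \<le> real (card (N B))"
  proof (rule ccontr)
    assume neg: "\<not> ?thesis"
    have ne: "nsets S b \<noteq> {}" using bs' fin by (simp add: nsets_eq_empty_iff)
    have "real (\<Sum>B\<in>nsets S b. card (N B)) < (\<Sum>B\<in>nsets S b. M ^ b / 2 * n)"
      unfolding of_nat_sum using neg ne fin
      by (intro sum_strict_mono) (auto simp: finite_imp_finite_nsets not_le)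
    also have "\<dots> = real (card S choose b) * (M ^ b / 2 * n)" by simp
    finally have "fact b * real (\<Sum>B\<in>nsets S b. card (N B)) < (fact b * real (card S choose b)) * (M ^ b / 2 * n)"
      by (simp add: mult.assoc)
    also have "\<dots> \<le> s ^ b * (M ^ b / 2 * n)"
      using fact_choose_upper[of b "card S"] M by (intro mult_right_mono) (auto simp: s_def n_def)
    also have "\<dots> = M ^ b / 2 * s ^ b * n" by simp
    also have "\<dots> \<le> (s * M - real b) ^ b * n"
      using half by (intro mult_right_mono) (auto simp: n_def)
    finally show False using tot by linarith
  qed
  then show ?thesis
    using that by (auto simp: nsets_def N_def n_def)
qed

text \<open>k0 and l0 are the clique sizes wanted. In the application w = R(k0, s), so that w
  vertices of high blue degree contain a blue clique of size s, from which b vertices are moved at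
  once; exp (a k) Q bounds R(k, l0) for k \<le> k0; and X counts as exhausted when |X| q < H. A red
  step may cost the factor exp (- a), a blue one exp (- m). \<alpha> and \<gamma> are thresholds for
  the ratio of the new q to the old one.\<close>

locale book =
  fixes E :: "'a \<Rightarrow> 'a \<Rightarrow> bool" and V :: "'a set"
    and p M a m \<eta> \<alpha> \<gamma> H Q :: real and c b s w k0 l0 :: nat
  assumes E: "symp E" "irreflp E" and V: "finite V"
    and p: "0 < p" "p < 1" and M: "0 < M" "M < 1" and c: "2 \<le> c"
    and ag: "0 < \<alpha>" "\<alpha> \<le> \<gamma>" "(1 - M) * \<alpha> + M * \<gamma> < 1 - \<eta>"
    and steps: "exp (- a) / p \<le> \<alpha> ^ c * (1 - M)" "1 / p \<le> \<gamma> ^ c" "exp (- m) \<le> M"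
    and b: "1 \<le> b" "2 * real b ^ 2 \<le> M * real s"
      "1 \<le> (1 - 1 / real c) ^ c * exp (m * real b) * (M ^ b / 2)"
    and W: "\<And>W. W \<subseteq> V \<Longrightarrow> w \<le> card W \<Longrightarrow> has_clique E W k0 \<or> has_clique (blue E) W s"
    and Y: "\<And>Z k. Z \<subseteq> V \<Longrightarrow> k \<le> k0 \<Longrightarrow> exp (a * real k) * Q \<le> real (card Z) \<Longrightarrow>
              has_clique E Z k \<or> has_clique (blue E) Z l0"
    and H: "0 < H" "2 * real w \<le> H" "2 * real w / p + 1 \<le> \<eta> * H"
    and Q: "0 < Q"
begin

definition potential :: "'a set \<Rightarrow> 'a set \<Rightarrow> real" where
  "potential X Y = real (card X) * real (card Y) * rel_excess E p X Y ^ c"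

text \<open>k and l are the sizes still missing. The red clique built so far is joined in red to
  both X and Y, so its rest may lie in their union; the blue one is joined in blue to X only, so Y
  has to supply all \<open>l0\<close> blue vertices.\<close>

definition goal :: "'a set \<Rightarrow> 'a set \<Rightarrow> nat \<Rightarrow> nat \<Rightarrow> bool" where
  "goal X Y k l \<longleftrightarrow> has_clique E (X \<union> Y) k \<or> has_clique (blue E) X l \<or> has_clique (blue E) Y l0"

lemma goal_mono: "goal X' Y' k l \<Longrightarrow> X' \<subseteq> X \<Longrightarrow> Y' \<subseteq> Y \<Longrightarrow> goal X Y k l"
  unfolding goal_def by (meson Un_mono has_clique_mono)

lemma E_sym: "E u v \<longleftrightarrow> E v u"
  using E(1) by (meson sympD)

lemma goal_red:
  assumes "goal X' (nbh E v Y) k l" "X' \<subseteq> nbh E v X" "v \<in> X"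
  shows "goal X Y (Suc k) l"
proof -
  have "X' \<subseteq> X" "nbh E v Y \<subseteq> Y" using assms(2) by (auto simp: nbh_def)
  moreover have "has_clique E (insert v (X' \<union> nbh E v Y)) (Suc k)" if "has_clique E (X' \<union> nbh E v Y) k"
  proof (rule has_clique_insert[OF that])
    show "v \<notin> X' \<union> nbh E v Y" using assms(2) by (auto simp: nbh_def)
    show "E u v \<and> E v u" if "u \<in> X' \<union> nbh E v Y" for u
      using that assms(2) E_sym[of u v] unfolding nbh_def by blast
  qed
  moreover have "insert v (X' \<union> nbh E v Y) \<subseteq> X \<union> Y"
    using assms calculation by auto
  ultimately show ?thesis using assms(1) unfolding goal_def
    by (meson has_clique_mono)
qed

lemma goal_blue:
  assumes "goal X' Y' k l" "X' \<subseteq> X" "Y' \<subseteq> Y" "B \<subseteq> X" "finite B" "pairwise (blue E) B"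
    and "\<And>u v. u \<in> X' \<Longrightarrow> v \<in> B \<Longrightarrow> u \<noteq> v \<and> \<not> E v u"
  shows "goal X Y k (l + card B)"
proof -
  have "has_clique (blue E) (X' \<union> B) (l + card B)" if "has_clique (blue E) X' l"
  proof (rule has_clique_union[OF that assms(5,6)])
    show "X' \<inter> B = {}" using assms(7) by blast
    show "\<not> E u v \<and> \<not> E v u" if "u \<in> X'" "v \<in> B" for u v
      using assms(7)[OF that] E_sym[of u v] by blast
  qed
  moreover have "X' \<union> B \<subseteq> X" "X' \<union> Y' \<subseteq> X \<union> Y" using assms by auto
  ultimately show ?thesis using assms(1,3) unfolding goal_def
    by (meson has_clique_mono)
qed

text \<open>From q \<le> 1 the potential is at most |Y| |X| q, which is below |Y| H. Hence Y still
  has exp (a k) Q vertices, enough for the locale assumption \<open>Y\<close>.\<close>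

lemma small_X:
  assumes XY: "Y \<subseteq> V" "finite X" "k \<le> k0" and pos: "0 < excess E p X Y"
    and pot: "exp (a * real k + m * real l) * (Q * H) \<le> potential X Y" and m: "0 \<le> m"
    and small: "real (card X) * rel_excess E p X Y < H"
  shows "goal X Y k l"
proof -
  define q where "q = rel_excess E p X Y"
  have fY: "finite Y" using XY V finite_subset by blast
  have q: "0 < q" "q \<le> 1"
  proof -
    show "q \<le> 1" using rel_excess_le[OF XY(2) fY _ pos] p by (simp add: q_def)
    show "0 < q" using pos excess_eq_rel_excess[OF XY(2) fY, of E p]
      by (metis mult_nonneg_nonneg of_nat_0_le_iff q_def zero_less_mult_pos2 linorder_not_less mult_eq_0_iff order_le_less)
  qed
  have "exp (a * real k) * Q * H \<le> exp (a * real k + m * real l) * (Q * H)"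
    using m Q H by (simp add: exp_add)
  also have "\<dots> \<le> real (card Y) * (real (card X) * q * q ^ (c - 1))"
    using pot c by (simp add: potential_def q_def mult_ac flip: power_Suc)
  also have "\<dots> \<le> real (card Y) * (real (card X) * q * 1)"
    using q by (intro mult_left_mono) (auto simp: power_le_one)
  also have "\<dots> \<le> real (card Y) * H"
    using small by (intro mult_left_mono) (auto simp: q_def)
  finally have "exp (a * real k) * Q \<le> real (card Y)" using H by simp
  from Y[OF XY(1,3) this] show ?thesis
    unfolding goal_def by (meson has_clique_mono sup_ge2)
qed

text \<open>Every step makes X strictly smaller and keeps the potential above the bound belonging to
  the sizes still missing. Deletions come first: afterwards every vertex of X has nearly average red
  degree into Y, so any subset of X inherits almost all of q.\<close>

lemma book_induct:
  assumes "X \<subseteq> V" "Y \<subseteq> V" "k \<le> k0" "0 < excess E p X Y"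
    "exp (a * real k + m * real l) * (Q * H) \<le> potential X Y"
  shows "goal X Y k l"
  using assms
proof (induction "card X" arbitrary: X Y k l rule: less_induct)
  case less
  note XV = less.prems(1) and YV = less.prems(2) and kk = less.prems(3) and pos = less.prems(4)
    and pot = less.prems(5)
  have fX: "finite X" and fY: "finite Y" using XV YV V finite_subset by blast+
  define n y q where "n = real (card X)" and "y = real (card Y)" and "q = rel_excess E p X Y"
  have ne: "X \<noteq> {}" "Y \<noteq> {}" using pos by (auto simp: excess_def nbh_def)
  have n: "0 < n" and y: "0 < y" using ne fX fY by (auto simp: n_def y_def card_gt_0_iff)
  have exq: "excess E p X Y = q * (n * y)"
    using excess_eq_rel_excess[OF fX fY] by (simp add: q_def n_def y_def)
  have q: "0 < q" using pos exq n y by (metis mult_pos_pos zero_less_mult_pos2)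
  have q1: "q \<le> 1" using rel_excess_le[OF fX fY _ pos] p by (simp add: q_def)
  have m0: "0 \<le> m" using steps(3) M by (smt (verit) one_le_exp_iff)
  have c1: "0 < c" using c by simp
  have potq: "exp (a * real k + m * real l) * (Q * H) \<le> n * y * q ^ c"
    using pot by (simp add: potential_def n_def y_def q_def)
  \<comment> \<open>A vertex is deleted if its excess into Y is at most 1 - 1/c times the
    average.\<close>
  consider "k = 0 \<or> l = 0" | "n * q < H"
    | (del) v where "v \<in> X" "q * y \<le> real c * (q * y - (real (card (nbh E v Y)) - p * y))"
    | (main) "0 < k" "0 < l" "H \<le> n * q"
        "\<And>v. v \<in> X \<Longrightarrow> real c * (q * y - (real (card (nbh E v Y)) - p * y)) < q * y"
    by (meson bot_nat_0.not_eq_extremum not_le)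
  then show ?case
  proof cases
    case 1
    then show ?thesis by (auto simp: goal_def)
  next
    case 2
    then show ?thesis
      using small_X[OF YV fX kk pos pot m0] by (simp add: n_def q_def)
  next
    case del
    let ?X' = "X - {v}"
    have d: "0 < excess E p ?X' Y"
      "n * q ^ c \<le> real (card ?X') * rel_excess E p ?X' Y ^ c"
      using delete_vertex[OF fX fY del(1) pos, of c] del(2) by (auto simp: n_def q_def y_def)
    have "goal ?X' Y k l"
    proof (rule less.hyps)
      show "card ?X' < card X" using del(1) fX by (meson card_Diff1_less)
      have "n * q ^ c * y \<le> real (card ?X') * rel_excess E p ?X' Y ^ c * y"
        using d(2) y by (intro mult_right_mono) auto
      then show "exp (a * real k + m * real l) * (Q * H) \<le> potential ?X' Y"
        using potq by (simp add: potential_def y_def mult_ac)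
    qed (use XV YV kk d in auto)
    then show ?thesis by (rule goal_mono) auto
  next
    case main
    have high: "(1 - 1 / real c) * q * y \<le> real (card (nbh E v Y)) - p * y" if "v \<in> X" for v
      using main(4)[OF that] c1 by (simp add: field_simps)
    have cpos: "0 \<le> (1 - 1 / real c) * q * y" using c q y by simp
    have Yv: "p * y \<le> real (card (nbh E v Y))" if "v \<in> X" for v
      using high[OF that] cpos by linarith
    \<comment> \<open>If \<open>B\<close> has w vertices, several blue steps are made at once.
      Otherwise \<open>B\<close> is too small to influence the average over X, and some vertex
      outside \<open>B\<close> admits a single red or blue step.\<close>
    define B where "B = {v\<in>X. M * n \<le> real (card (nbh (blue E) v X))}"
    have BX: "B \<subseteq> X" by (auto simp: B_def)
    show ?thesis
    proof (cases "w \<le> card B")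
      case True
      have "has_clique E B k0 \<or> has_clique (blue E) B s"
        using W[OF _ True] BX XV by blast
      then consider "has_clique E B k0" | "has_clique (blue E) B s" by blast
      then show ?thesis
      proof cases
        case 1
        then have "has_clique E X k"
          using has_clique_le[OF _ kk] has_clique_mono[OF _ BX] by blast
        then show ?thesis unfolding goal_def by (meson has_clique_mono sup_ge1)
      next
        case 2
        then obtain S where S: "S \<subseteq> B" "finite S" "card S = s" "pairwise (blue E) S"
          unfolding has_clique_def by blast
        have sb: "symp (blue E)" using E(1) by (auto simp: symp_def)
        obtain T where T: "T \<subseteq> S" "card T = b"
            "M ^ b / 2 * n \<le> real (card {u\<in>X. \<forall>v\<in>T. u \<noteq> v \<and> \<not> E v u})"
          using common_neighbourhood[OF fX S(2) sb, of M b] M b S unfolding B_def n_def by blast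
        show ?thesis
        proof (cases "l < b")
          case True
          have "pairwise (blue E) T" "finite T" using S T pairwise_subset finite_subset by blast+
          then have "has_clique (blue E) X b"
            unfolding has_clique_def using T S BX by blast
          then have "has_clique (blue E) X l" using has_clique_le True by (metis less_imp_le)
          then show ?thesis by (simp add: goal_def)
        next
          case False
          define X' where "X' = {u\<in>X. \<forall>v\<in>T. u \<noteq> v \<and> \<not> E v u}"
          have X'X: "X' \<subseteq> X" and fX': "finite X'" using fX by (auto simp: X'_def)
          have T': "T \<subseteq> X" "finite T" "pairwise (blue E) T"
            using T S BX pairwise_subset finite_subset by blast+
          have cX': "M ^ b / 2 * n \<le> real (card X')" using T(3) by (simp add: X'_def)
          have nX': "0 < real (card X')" using cX' M n
            by (smt (verit) divide_pos_pos mult_pos_pos zero_less_power)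
          have exX': "(1 - 1 / real c) * q * (real (card X') * y) \<le> excess E p X' Y"
          proof -
            have "(\<Sum>v\<in>X'. (1 - 1 / real c) * q * y) \<le> excess E p X' Y"
              unfolding excess_def using high X'X by (intro sum_mono) (auto simp: y_def)
            then show ?thesis by (simp add: mult_ac)
          qed
          have c1pos: "0 < 1 - 1 / real c" using c by simp
          have pos': "0 < excess E p X' Y"
            using exX' c1pos q nX' y by (smt (verit) mult_pos_pos)
          have rq: "(1 - 1 / real c) * q \<le> rel_excess E p X' Y"
            unfolding rel_excess_def using exX' nX' y by (simp add: pos_le_divide_eq y_def)
          have "goal X' Y k (l - b)"
          proof (rule less.hyps)
            have "T \<noteq> {}" using T b by auto
            then have "X' \<noteq> X" using T' by (auto simp: X'_def)
            then show "card X' < card X" using X'X fX by (simp add: psubsetI psubset_card_mono)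
            have "exp (a * real k + m * real (l - b)) * (Q * H)
                = exp (- (m * real b)) * (exp (a * real k + m * real l) * (Q * H))"
              using False by (simp add: exp_add exp_diff exp_minus of_nat_diff right_diff_distrib divide_inverse mult_ac)
            also have "\<dots> \<le> exp (- (m * real b)) * (n * y * q ^ c)"
              using potq by (intro mult_left_mono) auto
            also have "\<dots> \<le> exp (- (m * real b)) * (n * y * q ^ c) *
                 ((1 - 1 / real c) ^ c * exp (m * real b) * (M ^ b / 2))"
            proof -
              have "0 \<le> exp (- (m * real b)) * (n * y * q ^ c)" using n y q by simp
              from mult_left_mono[OF b(3) this] show ?thesis by simp
            qed
            also have "\<dots> = (M ^ b / 2 * n) * y * ((1 - 1 / real c) * q) ^ c"
              by (simp add: power_mult_distrib exp_minus)
            also have "\<dots> \<le> real (card X') * y * rel_excess E p X' Y ^ c"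
              using cX' rq c1pos q y M n by (intro mult_mono power_mono) (auto intro!: mult_nonneg_nonneg)
            finally show "exp (a * real k + m * real (l - b)) * (Q * H) \<le> potential X' Y"
              by (simp add: potential_def y_def)
          qed (use X'X XV YV kk pos' in auto)
          from goal_blue[OF this X'X _ T', of Y] show ?thesis
            using False T(2) by (auto simp: X'_def)
        qed
      qed
    next
      case False
      have nH: "H \<le> n" using main(3) q1 n by (smt (verit) mult_left_le)
      have wn: "2 * real w \<le> n" using nH H by linarith
      \<comment> \<open>The change of the excess when Y shrinks to the red neighbourhood of v,
        measured against density p + q. The sum over X is nonnegative and the part over
        \<open>B\<close> at most w n y, so among the at least n/2 other vertices one loses at most 2
        w y.\<close>
      define g where "g v = excess E p X (nbh E v Y) - q * n * real (card (nbh E v Y))" for v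
      have fB: "finite B" using BX fX finite_subset by blast
      have "0 \<le> sum g X"
        using excess_average[OF fX fY E, of p] p by (simp add: g_def q_def n_def)
      also have "sum g X = sum g (X - B) + sum g B" by (rule sum.subset_diff[OF BX fX])
      finally have sg: "- sum g B \<le> sum g (X - B)" by simp
      have "sum g B \<le> (\<Sum>v\<in>B. n * y)"
      proof (rule sum_mono)
        fix v
        have "excess E p X (nbh E v Y) \<le> (1 - p) * (n * real (card (nbh E v Y)))"
          using excess_le[OF fX, of "nbh E v Y" p E] fY p by (simp add: n_def)
        also have "\<dots> \<le> 1 * (n * y)"
          using p n card_nbh_le[OF fY, of E v] by (intro mult_mono) (auto simp: y_def)
        finally show "g v \<le> n * y" unfolding g_def using q n
          by (smt (verit) mult_nonneg_nonneg of_nat_0_le_iff)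
      qed
      also have "\<dots> \<le> real w * (n * y)"
        using False n y by (simp add: mult_right_mono)
      finally have sgB: "- (real w * (n * y)) \<le> sum g (X - B)" using sg by linarith
      have cXB: "n / 2 \<le> real (card (X - B))"
        using False wn fB BX by (simp add: card_Diff_subset of_nat_diff n_def card_mono fX)
      have XBne: "X - B \<noteq> {}"
      proof
        assume "X - B = {}"
        then have "card (X - B) = 0" by (metis card.empty)
        then show False using cXB n by simp
      qed
      have "\<exists>v\<in>X - B. - (2 * real w * y) \<le> g v"
      proof (rule ccontr)
        assume "\<not> ?thesis"
        then have "sum g (X - B) < (\<Sum>v\<in>X - B. - (2 * real w * y))"
          using fX by (intro sum_strict_mono[OF _ XBne]) (auto simp: not_le)
        also have "\<dots> = - (2 * real w * y) * real (card (X - B))" by simp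
        also have "\<dots> \<le> - (2 * real w * y) * (n / 2)"
          using cXB y by (intro mult_left_mono_neg) auto
        finally show False using sgB by (simp add: mult_ac)
      qed
      then obtain v where v: "v \<in> X" "v \<notin> B" "- (2 * real w * y) \<le> g v" by blast
      define Yv where "Yv = nbh E v Y"
      define yv where "yv = real (card Yv)"
      define Xr where "Xr = nbh E v X"
      define Xb where "Xb = nbh (blue E) v X"
      have fs: "finite Yv" "finite Xr" "finite Xb" using fX fY by (auto simp: Yv_def Xr_def Xb_def)
      have yvp: "p * y \<le> yv" using Yv[OF v(1)] by (simp add: yv_def Yv_def)
      have yv: "0 < yv" using yvp p y by (smt (verit) mult_pos_pos)
      have Xeq: "X = (Xr \<union> Xb) \<union> {v}" using v(1) by (auto simp: Xr_def Xb_def nbh_def)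
      have disj: "Xr \<inter> Xb = {}" "(Xr \<union> Xb) \<inter> {v} = {}" by (auto simp: Xr_def Xb_def nbh_def)
      have exX: "excess E p X Yv = excess E p Xr Yv + excess E p Xb Yv + excess E p {v} Yv"
        using excess_Un[of "Xr \<union> Xb" "{v}" E p Yv] excess_Un[of Xr Xb E p Yv] disj fs Xeq by simp
      have "excess E p {v} Yv \<le> yv"
        using excess_le[of "{v}" Yv p E] fs p by (simp add: yv_def) (smt (verit) mult_left_le_one_le of_nat_0_le_iff)
      moreover have "g v = excess E p X Yv - q * n * yv" by (simp add: g_def Yv_def yv_def)
      moreover have "2 * real w * y \<le> 2 * real w / p * yv"
        using mult_left_mono[OF yvp, of "2 * real w"] p by (simp add: field_simps)
      ultimately have sumex: "yv * (q * n - 2 * real w / p - 1) \<le> excess E p Xr Yv + excess E p Xb Yv"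
        using exX v(3) by (simp add: algebra_simps)
      \<comment> \<open>The errors, 2 w / p from the choice of v and 1 from v itself, are at most a
        fraction \<eta> of q n because H \<le> q n.\<close>
      have "\<eta> * H \<le> \<eta> * (q * n)"
      proof -
        have "0 < \<eta> * H" using H p by (smt (verit) divide_nonneg_pos of_nat_0_le_iff)
        then have "0 < \<eta>" using H(1) by (simp add: zero_less_mult_iff)
        then show ?thesis using main(3) by (simp add: mult.commute)
      qed
      then have "(1 - \<eta>) * (q * n) \<le> q * n - 2 * real w / p - 1"
        using H(3) by (simp add: algebra_simps)
      then have sumex2: "yv * ((1 - \<eta>) * (q * n)) \<le> excess E p Xr Yv + excess E p Xb Yv"
        using sumex yv by (smt (verit) mult_left_mono)
      \<comment> \<open>Proportions of the red and the blue neighbourhood in X, and below the ratios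
        of their new q to the old one; their weighted mean is almost 1, as
        \<open>red_or_blue_step\<close> demands.\<close>
      define r \<beta> where "r = real (card Xr) / n" and "\<beta> = real (card Xb) / n"
      define \<rho> \<sigma> where "\<rho> = rel_excess E p Xr Yv / q" and "\<sigma> = rel_excess E p Xb Yv / q"
      have er: "excess E p Xr Yv = r * \<rho> * (q * n * yv)"
        using excess_eq_rel_excess[of Xr Yv E p] fs q n by (simp add: r_def \<rho>_def yv_def)
      have eb: "excess E p Xb Yv = \<beta> * \<sigma> * (q * n * yv)"
        using excess_eq_rel_excess[of Xb Yv E p] fs q n by (simp add: \<beta>_def \<sigma>_def yv_def)
      have "(1 - \<eta>) * (q * n * yv) \<le> (r * \<rho> + \<beta> * \<sigma>) * (q * n * yv)"
        using sumex2 er eb by (simp add: algebra_simps)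
      then have mean: "1 - \<eta> \<le> r * \<rho> + \<beta> * \<sigma>" using q n yv by simp
      have "card Xr + card Xb + 1 = card X"
        using Xeq fs disj by (subst Xeq) (simp add: card_Un_disjoint)
      then have rb: "r + \<beta> \<le> 1" using n by (simp add: r_def \<beta>_def n_def field_simps flip: of_nat_add)
      have bM: "\<beta> \<le> M" using v n by (simp add: B_def \<beta>_def Xb_def pos_divide_le_eq)
      have "0 < \<rho> \<and> exp (- a) \<le> r * p * \<rho> ^ c \<or> 0 < \<sigma> \<and> exp (- m) \<le> \<beta> * p * \<sigma> ^ c"
        using p M c1 ag steps rb bM mean n
        by (intro red_or_blue_step[of p M c \<alpha> \<gamma> \<eta>]) (auto simp: r_def \<beta>_def)
      then show ?thesis
      proof (elim disjE conjE)
        assume *: "0 < \<rho>" "exp (- a) \<le> r * p * \<rho> ^ c"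
        have r0: "0 < r" using *(2) by (smt (verit) divide_nonneg_nonneg exp_gt_zero mult_eq_0_iff n of_nat_0_le_iff r_def)
        have "goal Xr Yv (k - 1) l"
        proof (rule less.hyps)
          show "card Xr < card X" using \<open>card Xr + card Xb + 1 = card X\<close> by simp
          show "0 < excess E p Xr Yv" unfolding er using * r0 q n yv by simp
          show "Xr \<subseteq> V" "Yv \<subseteq> V" "k - 1 \<le> k0"
            using XV YV kk by (auto simp: Xr_def Yv_def nbh_def)
          have "exp (a * real (k - 1) + m * real l) * (Q * H) = exp (- a) * (exp (a * real k + m * real l) * (Q * H))"
            using main(1) by (simp add: of_nat_diff algebra_simps flip: exp_add)
          also have "\<dots> \<le> (r * p * \<rho> ^ c) * (n * y * q ^ c)"
            using * r0 p Q H by (intro mult_mono[OF *(2) potq]) auto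
          also have "\<dots> = (r * n) * (p * y) * (\<rho> * q) ^ c" by (simp add: power_mult_distrib)
          also have "\<dots> \<le> (r * n) * yv * (\<rho> * q) ^ c"
            using yvp r0 n * q by (intro mult_right_mono mult_left_mono) auto
          also have "\<dots> = potential Xr Yv"
            using n q by (simp add: potential_def r_def \<rho>_def yv_def)
          finally show "exp (a * real (k - 1) + m * real l) * (Q * H) \<le> potential Xr Yv" .
        qed
        from goal_red[OF this[unfolded Yv_def] _ v(1)] show ?thesis
          using main(1) by (simp add: Xr_def)
      next
        assume *: "0 < \<sigma>" "exp (- m) \<le> \<beta> * p * \<sigma> ^ c"
        have r0: "0 < \<beta>" using *(2) by (smt (verit) divide_nonneg_nonneg exp_gt_zero mult_eq_0_iff n of_nat_0_le_iff \<beta>_def)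
        have "goal Xb Yv k (l - 1)"
        proof (rule less.hyps)
          show "card Xb < card X" using \<open>card Xr + card Xb + 1 = card X\<close> by simp
          show "0 < excess E p Xb Yv" unfolding eb using * r0 q n yv by simp
          show "Xb \<subseteq> V" "Yv \<subseteq> V" "k \<le> k0"
            using XV YV kk by (auto simp: Xb_def Yv_def nbh_def)
          have "exp (a * real k + m * real (l - 1)) * (Q * H) = exp (- m) * (exp (a * real k + m * real l) * (Q * H))"
            using main(2) by (simp add: of_nat_diff algebra_simps flip: exp_add)
          also have "\<dots> \<le> (\<beta> * p * \<sigma> ^ c) * (n * y * q ^ c)"
            using * r0 p Q H by (intro mult_mono[OF *(2) potq]) auto
          also have "\<dots> = (\<beta> * n) * (p * y) * (\<sigma> * q) ^ c" by (simp add: power_mult_distrib)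
          also have "\<dots> \<le> (\<beta> * n) * yv * (\<sigma> * q) ^ c"
            using yvp r0 n * q by (intro mult_right_mono mult_left_mono) auto
          also have "\<dots> = potential Xb Yv"
            using n q by (simp add: potential_def \<beta>_def \<sigma>_def yv_def)
          finally show "exp (a * real k + m * real (l - 1)) * (Q * H) \<le> potential Xb Yv" .
        qed
        then have "goal X Y k (l - 1 + card {v})"
        proof (rule goal_blue)
          show "Xb \<subseteq> X" "Yv \<subseteq> Y" unfolding Xb_def Yv_def by (rule nbh_subset)+
          show "u \<noteq> x \<and> \<not> E x u" if "u \<in> Xb" "x \<in> {v}" for u x
            using that by (simp add: Xb_def nbh_def)
        qed (use v(1) in \<open>auto simp: pairwise_def\<close>)
        then show ?thesis using main(2) by simp
      qed
    qed
  qed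
qed

end

section \<open>The exponent and its admissible parameters\<close>

definition dG :: "real \<Rightarrow> real" where
  "dG x = (- (1/4) + (31/100) * x + (21/100) * x^2 - (2/25) * x^3) * exp (- x)"

definition F :: "real \<Rightarrow> real" where
  "F x = G x + (1 + x) * ln (1 + x) - x * ln x"

definition dF :: "real \<Rightarrow> real" where
  "dF x = dG x + ln (1 + x) - ln x"

lemma DERIV_F:
  assumes "0 < x"
  shows "DERIV F x :> dF x"
proof -
  have "DERIV F x :> dG x + (ln (1 + x) + (1 + x) * (1 / (1 + x))) - (ln x + x * (1 / x))"
    unfolding F_def[abs_def] G_def[abs_def] dG_def
    by (rule derivative_eq_intros refl | use assms in \<open>simp; fail\<close>)+
      (use assms in \<open>simp add: algebra_simps power2_eq_square power3_eq_cube\<close>)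
  moreover have "dG x + (ln (1 + x) + (1 + x) * (1 / (1 + x))) - (ln x + x * (1 / x)) = dF x"
    using assms by (simp add: dF_def)
  ultimately show ?thesis by simp
qed

definition ddF :: "real \<Rightarrow> real" where
  "ddF x = ((14/25) + (11/100) * x - (9/20) * x^2 + (2/25) * x^3) * exp (- x) + 1 / (1 + x) - 1 / x"

lemma DERIV_dF:
  assumes "0 < x"
  shows "DERIV dF x :> ddF x"
  unfolding dF_def[abs_def] dG_def[abs_def] ddF_def
  by (rule derivative_eq_intros refl | use assms in \<open>simp; fail\<close>)+
    (use assms in \<open>simp add: algebra_simps power2_eq_square power3_eq_cube\<close>)

text \<open>The entropy part contributes - 1/(x (1 + x)). This outweighs the second derivative of G,
  a polynomial that is at most 1 on the interval times exp (- x) \<le> 1/(1 + x).\<close>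

lemma ddF_nonpos:
  assumes "0 < x" "x \<le> 1"
  shows "ddF x \<le> 0"
proof -
  have e: "exp (- x) \<le> 1 / (1 + x)"
    using assms exp_ge_add_one_self[of x] by (simp add: exp_minus inverse_eq_divide frac_le)
  have "(14/25) + (11/100) * x - (9/20) * x^2 + (2/25) * x^3 \<le> 1"
  proof -
    have "x^3 \<le> 1" "0 \<le> x^2" using assms by (auto intro: power_le_one)
    then show ?thesis using assms by linarith
  qed
  then have "((14/25) + (11/100) * x - (9/20) * x^2 + (2/25) * x^3) * exp (- x) \<le> 1 * exp (- x)"
    by (intro mult_right_mono) auto
  also have "\<dots> \<le> 1 / (1 + x)" using e by simp
  also have "\<dots> \<le> 1 / (x * (1 + x))"
    using assms by (intro divide_left_mono) auto
  also have "\<dots> = 1 / x - 1 / (1 + x)" using assms by (simp add: field_simps)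
  finally show ?thesis by (simp add: ddF_def)
qed

lemma dF_antimono:
  assumes "0 < x" "x \<le> y" "y \<le> 1"
  shows "dF y \<le> dF x"
proof (rule DERIV_nonpos_imp_nonincreasing[OF assms(2)])
  fix z assume "x \<le> z" "z \<le> y"
  then show "\<exists>d. DERIV dF z :> d \<and> d \<le> 0"
    using assms DERIV_dF[of z] ddF_nonpos[of z] by (intro exI[of _ "ddF z"]) auto
qed

lemma concave_F: "concave_on {0<..1} F"
  by (rule f''_le0_imp_concave[where f' = dF and f'' = ddF]) (auto intro: DERIV_F DERIV_dF ddF_nonpos)

lemma F_le_tangent:
  assumes "0 < x" "x \<le> 1" "0 < y" "y \<le> 1"
  shows "F y \<le> F x + dF x * (y - x)"
proof -
  have "(- dF x) * (y - x) \<le> (- F y) - (- F x)"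
    by (rule f''_imp_f'[where C = "{0<..1}" and f'' = "\<lambda>x. - ddF x"])
      (use assms in \<open>auto intro!: DERIV_F DERIV_dF derivative_intros simp: ddF_nonpos\<close>)
  then show ?thesis by simp
qed

lemma G_eq: "G x = (- (1/4) * x + (3/100) * x^2 + (2/25) * x^3) * exp (- x)"
  by (simp add: G_def)

lemma G_nonpos:
  assumes "0 \<le> x" "x \<le> 1"
  shows "G x \<le> 0"
proof -
  have "x^2 \<le> x" "x^3 \<le> x"
    using assms power_decreasing[of 1 2 x] power_decreasing[of 1 3 x] by auto
  then have "- (1/4) * x + (3/100) * x^2 + (2/25) * x^3 \<le> 0" using assms by linarith
  then show ?thesis unfolding G_eq by (intro mult_nonpos_nonneg) auto
qed

lemma G_lower:
  assumes "0 \<le> x"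
  shows "- (1/4) * x \<le> G x"
proof -
  have "- (1/4) * x * 1 \<le> - (1/4) * x * exp (- x)"
    using assms by (intro mult_left_mono_neg) auto
  also have "\<dots> \<le> G x"
    unfolding G_eq using assms by (intro mult_right_mono) auto
  finally show ?thesis by simp
qed

text \<open>\<open>region a b\<close> says that \<open>R(k,l) \<le> exp (a k + b l + o(k + l))\<close> follows from the
  bound \<open>R(k,l) \<le> exp (k F(l/k) + o(k))\<close> for \<open>l \<le> k\<close>.\<close>

definition region :: "real \<Rightarrow> real \<Rightarrow> bool" where
  "region a b \<longleftrightarrow> (\<forall>x\<in>{0<..1}. F x \<le> a + x * b \<and> F x \<le> b + x * a)"

lemma region_commute: "region a b \<longleftrightarrow> region b a"
  by (auto simp: region_def)

text \<open>As x \<le> 1, the larger coefficient does more good as the constant term, so the other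
  inequality follows.\<close>

lemma region_le:
  assumes "a \<le> b" "\<And>x. 0 < x \<Longrightarrow> x \<le> 1 \<Longrightarrow> F x \<le> a + x * b"
  shows "region a b"
  unfolding region_def
proof safe
  fix x :: real assume x: "x \<in> {0<..1}"
  then show "F x \<le> a + x * b" using assms(2) by auto
  moreover have "0 \<le> (1 - x) * (b - a)" using x assms(1) by (intro mult_nonneg_nonneg) auto
  ultimately show "F x \<le> b + x * a" by (simp add: algebra_simps)
qed

lemma region_tangent:
  assumes "0 < y" "y \<le> 1" "F y - y * dF y \<le> a" "dF y \<le> b" "a \<le> b"
  shows "region a b"
proof (rule region_le[OF assms(5)])
  fix x :: real assume x: "0 < x" "x \<le> 1"
  have "F x \<le> (F y - y * dF y) + x * dF y"
    using F_le_tangent[OF assms(1,2) x] by (simp add: algebra_simps)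
  also have "\<dots> \<le> a + x * b" using assms x by (intro add_mono mult_left_mono) auto
  finally show "F x \<le> a + x * b" .
qed

text \<open>The exponent, extended symmetrically to l > k, has a concave kink at k = l, since the
  slope \<open>dF 1\<close> exceeds F(1)/2. The pairs treated here are the lines supporting it at
  that kink; they fill the gap between the tangents on the two sides.\<close>

lemma region_corner:
  assumes "F 1 \<le> a + b" "a \<le> dF 1" "b \<le> dF 1"
  shows "region a b"
  unfolding region_def
proof safe
  fix x :: real assume x: "x \<in> {0<..1}"
  have 1: "F x \<le> a + b - dF 1 * (1 - x)"
    using F_le_tangent[of 1 x] x assms(1) by (simp add: algebra_simps)
  have 2: "b * (1 - x) \<le> dF 1 * (1 - x)" "a * (1 - x) \<le> dF 1 * (1 - x)"
    using assms x by (auto intro: mult_right_mono)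
  show "F x \<le> a + x * b" using 1 2(1) by (simp add: algebra_simps)
  show "F x \<le> b + x * a" using 1 2(2) by (simp add: algebra_simps)
qed

(* Gibbs' inequality against the distribution (1/(1+x), x/(1+x)). *)
lemma region_Erdos_Szekeres:
  assumes "exp (- a) + exp (- b) \<le> 1"
  shows "region a b"
proof -
  have *: "F x \<le> a + x * b" if "0 < x" "x \<le> 1" and ab: "exp (- a) + exp (- b) \<le> 1" for x a b :: real
  proof -
    have "ln (exp (- a) * (1 + x)) \<le> exp (- a) * (1 + x) - 1"
      using that by (intro ln_le_minus_one) auto
    then have 1: "- a + ln (1 + x) \<le> exp (- a) * (1 + x) - 1"
      using that by (simp add: ln_mult)
    have "ln (exp (- b) * ((1 + x) / x)) \<le> exp (- b) * ((1 + x) / x) - 1"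
      using that by (intro ln_le_minus_one) auto
    then have "- b + ln (1 + x) - ln x \<le> exp (- b) * ((1 + x) / x) - 1"
      using that by (simp add: ln_mult ln_div)
    from mult_left_mono[OF this, of x] that
    have "x * (- b + ln (1 + x) - ln x) \<le> x * (exp (- b) * ((1 + x) / x) - 1)" by simp
    also have "\<dots> = exp (- b) * (1 + x) - x" using that by (simp add: field_simps)
    finally have 2: "x * (- b + ln (1 + x) - ln x) \<le> exp (- b) * (1 + x) - x" .
    have "(1 + x) * (exp (- a) + exp (- b)) \<le> (1 + x) * 1"
      using that by (intro mult_left_mono) auto
    then have "- a + ln (1 + x) + x * (- b + ln (1 + x) - ln x) \<le> 0"
      using 1 2 by (simp add: algebra_simps)
    then show ?thesis
      using G_nonpos[of x] that unfolding F_def by (simp add: algebra_simps)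
  qed
  have "exp (- b) + exp (- a) \<le> 1" using assms by simp
  then show ?thesis unfolding region_def using * assms by auto
qed

text \<open>The parameters \<open>p\<close>, \<open>M\<close>, \<open>a\<close>, \<open>b\<close> are the red density, the largest blue density
  of a step, \<open>- ln X\<close> and \<open>- ln Y\<close> of the paper.\<close>

definition admissible :: "real \<Rightarrow> bool" where
  "admissible l \<longleftrightarrow> (\<exists>p M a b. 0 < p \<and> p < 1 \<and> 0 < M \<and> M < 1 \<and> 0 \<le> a \<and> 0 \<le> b \<and>
     - dF l \<le> ln (1 - p) \<and> - ln p \<le> (1 - M) * (a + ln (1 - M)) \<and> region a b \<and>
     a + l * (b - ln M) \<le> 2 * F l)"

section \<open>Numerical verification\<close>

text \<open>Interpolating a table by polynomials of low degree keeps the fractions in the checks below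
  small. \<open>ln_approx k x\<close> is meant for \<open>x/2^k\<close> between (9/20) and 1.\<close>

fun exp_interp :: "(real \<times> real) list \<Rightarrow> real \<Rightarrow> real" where
  "exp_interp [] x = 0"
| "exp_interp ((a, e) # xs) x =
     (if x \<le> a + 1/20 then e * (1 - (x - a) + (x - a) * (x - a) / 2) else exp_interp xs x)"

text \<open>The first argument is where the range of the earlier nodes ends, so an accepted table
  leaves no gap up to 1.\<close>

fun exp_table :: "real \<Rightarrow> (real \<times> real) list \<Rightarrow> bool" where
  "exp_table l [] \<longleftrightarrow> 1 < l"
| "exp_table l ((a, e) # xs) \<longleftrightarrow> a - 1/20 \<le> l \<and> 0 \<le> e \<and> e \<le> 1 \<and>
     \<bar>exp (- a) - e\<bar> \<le> 1/1000000 \<and> exp_table (a + 1/20) xs"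

definition exp_approx :: "real \<Rightarrow> real" where
  "exp_approx = exp_interp [(0, 1), (1/10, (904837/1000000)), (2/10, (818731/1000000)), (3/10, (370409/500000)),
     (4/10, (8379/12500)), (5/10, (606531/1000000)), (6/10, (137203/250000)), (7/10, (99317/200000)), (8/10, (449329/1000000)),
     (9/10, (40657/100000)), (1, (367879/1000000))]"

definition G_approx :: "real \<Rightarrow> real" where
  "G_approx x = x * (x * ((3/100) + (2/25) * x) - (1/4)) * exp_approx x"

definition dG_approx :: "real \<Rightarrow> real" where
  "dG_approx x = (x * ((31/100) + x * ((21/100) - (2/25) * x)) - (1/4)) * exp_approx x"

fun ln_interp :: "(real \<times> real \<times> real) list \<Rightarrow> real \<Rightarrow> real" where
  "ln_interp [] x = 0"
| "ln_interp ((r, a, e) # xs) x = (if x \<le> r then e + 2 * ((x - a) / (x + a)) else ln_interp xs x)"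

fun ln_table :: "real \<Rightarrow> (real \<times> real \<times> real) list \<Rightarrow> bool" where
  "ln_table l [] \<longleftrightarrow> 2 < l"
| "ln_table l ((r, a, e) # xs) \<longleftrightarrow> 0 < a \<and> l \<le> r \<and> a \<le> (1047/1000) * l \<and> r \<le> (1047/1000) * a \<and>
     \<bar>ln a - e\<bar> \<le> 1/1000000 \<and> ln_table r xs"

definition ln_approx :: "nat \<Rightarrow> real \<Rightarrow> real" where
  "ln_approx k x = ln_interp [((49/50), (47/50), - (99/1600)), ((53/50), (51/50), (19803/1000000)), ((23/20), (11/10), (9531/100000)),
     ((5/4), (6/5), (91161/500000)), ((34/25), (13/10), (65591/250000)), ((37/25), (71/50), (350657/1000000)), ((161/100), (77/50), (215891/500000)),
     ((7/4), (42/25), (259397/500000)), ((191/100), (183/100), (151079/250000)), ((2001/1000), (39/20), (667829/1000000))] (2 * x / 2^k)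
     + (real k * (693147/1000000) - (693147/1000000))"

section \<open>Error bounds for the tabulated functions\<close>

lemma exp_minus_Taylor:
  fixes x :: real
  assumes "exp \<bar>x\<bar> \<le> c"
  shows "\<bar>exp (- x) - (\<Sum>m<n. (- x) ^ m / fact m)\<bar> \<le> c / fact n * \<bar>x\<bar> ^ n"
proof -
  obtain t where t: "\<bar>t\<bar> \<le> \<bar>- x\<bar>"
    "exp (- x) = (\<Sum>m<n. (- x) ^ m / fact m) + exp t / fact n * (- x) ^ n"
    using Maclaurin_exp_le by blast
  have "exp t \<le> exp \<bar>x\<bar>" using t by simp
  then have "exp t \<le> c" using assms by linarith
  then have "exp t / fact n * \<bar>x\<bar> ^ n \<le> c / fact n * \<bar>x\<bar> ^ n"
    using assms by (intro mult_right_mono divide_right_mono) auto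
  moreover have "\<bar>exp t / fact n * (- x) ^ n\<bar> = exp t / fact n * \<bar>x\<bar> ^ n"
    by (simp add: abs_mult power_abs)
  ultimately show ?thesis using t(2) by simp
qed

text \<open>At distance at most 1/20 from a node the quadratic Taylor polynomial is off by at most
  1/45600; the rounded table entry adds little more than 1/1000000.\<close>

lemma exp_interp:
  assumes "exp_table l xs" "l \<le> x" "x \<le> 1"
  shows "\<bar>exp (- x) - exp_interp xs x\<bar> \<le> 1/40000"
  using assms
proof (induction l xs rule: exp_table.induct)
  case (2 l a e xs)
  show ?case
  proof (cases "x \<le> a + 1/20")
    case True
    define h where "h = x - a"
    define T where "T = 1 - h + h * h / 2"
    have h: "\<bar>h\<bar> \<le> 1/20" using True "2.prems" by (intro abs_leI) (auto simp: h_def)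
    have "1 - \<bar>h\<bar> \<le> exp (- \<bar>h\<bar>)" using exp_ge_add_one_self[of "- \<bar>h\<bar>"] by simp
    then have "19/20 \<le> exp (- \<bar>h\<bar>)" using h by linarith
    then have eh: "exp \<bar>h\<bar> \<le> 20/19" by (simp add: exp_minus field_simps)
    have "(\<Sum>m<3. (- h) ^ m / fact m) = T" by (simp add: T_def eval_nat_numeral)
    then have "\<bar>exp (- h) - T\<bar> \<le> 20/114 * \<bar>h\<bar> ^ 3"
      using exp_minus_Taylor[OF eh, of 3] by (simp add: fact_numeral)
    moreover have "\<bar>h\<bar> ^ 3 \<le> (1/20) ^ 3" using h by (intro power_mono) auto
    moreover have "(1/20 :: real) ^ 3 = 1/8000" by (simp add: power_divide)
    ultimately have T: "\<bar>exp (- h) - T\<bar> \<le> 1/45600" by simp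
    have "exp (- h) \<le> exp \<bar>h\<bar>" by simp
    then have eh2: "exp (- h) \<le> 20/19" using eh by linarith
    have e: "\<bar>exp (- a) - e\<bar> \<le> 1/1000000" "0 \<le> e" "e \<le> 1" using 2 by auto
    have "exp (- x) = exp (- a) * exp (- h)" by (simp add: h_def flip: exp_add)
    then have "exp (- x) - e * T = (exp (- a) - e) * exp (- h) + e * (exp (- h) - T)"
      by (simp add: algebra_simps)
    then have "\<bar>exp (- x) - e * T\<bar> \<le> \<bar>exp (- a) - e\<bar> * exp (- h) + e * \<bar>exp (- h) - T\<bar>"
      using e abs_triangle_ineq[of "(exp (- a) - e) * exp (- h)" "e * (exp (- h) - T)"]
      by (simp add: abs_mult)
    also have "\<dots> \<le> 1/1000000 * (20/19) + 1 * (1/45600)"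
      using e eh2 T by (intro add_mono mult_mono) auto
    also have "\<dots> \<le> 1/40000" by simp
    finally show ?thesis using True by (simp add: T_def h_def)
  next
    case False
    then show ?thesis using 2 by simp
  qed
qed auto

lemma exp_approx:
  assumes "0 \<le> x" "x \<le> 1"
  shows "\<bar>exp (- x) - exp_approx x\<bar> \<le> 1/40000"
  unfolding exp_approx_def
proof (rule exp_interp[OF _ assms])
  \<comment> \<open>Eleven Taylor terms leave at most 3/11!, below 1/10000000, so a rational
    comparison up to 9/10000000 suffices.\<close>
  have *: "\<bar>exp (- a) - e\<bar> \<le> 1/1000000"
    if "\<bar>(\<Sum>m<11. (- a) ^ m / fact m) - e\<bar> \<le> 9/10000000" "0 \<le> a" "a \<le> 1" for a e :: real
  proof -
    have "exp \<bar>a\<bar> \<le> exp 1" using that by simp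
    then have "exp \<bar>a\<bar> \<le> 3" using exp_le by linarith
    from exp_minus_Taylor[OF this, of 11]
    have "\<bar>exp (- a) - (\<Sum>m<11. (- a) ^ m / fact m)\<bar> \<le> 3 / fact 11 * \<bar>a\<bar> ^ 11" .
    also have "\<dots> \<le> 3 / fact 11 * 1" using that by (intro mult_left_mono power_le_one) auto
    also have "\<dots> \<le> 1/10000000" by (simp add: fact_numeral)
    finally show ?thesis using that(1) by linarith
  qed
  show "exp_table 0 [(0, 1), (1/10, (904837/1000000)), (2/10, (818731/1000000)), (3/10, (370409/500000)),
     (4/10, (8379/12500)), (5/10, (606531/1000000)), (6/10, (137203/250000)), (7/10, (99317/200000)), (8/10, (449329/1000000)),
     (9/10, (40657/100000)), (1, (367879/1000000))]"
    unfolding exp_table.simps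
    by (intro conjI *) (simp_all add: lessThan_nat_numeral lessThan_Suc fact_numeral power_divide)
qed

lemma G_approx:
  assumes "0 \<le> x" "x \<le> 1"
  shows "\<bar>G x - G_approx x\<bar> \<le> 1/100000"
proof -
  have x: "x^2 \<le> x" "x^3 \<le> x" "0 \<le> x^2" "0 \<le> x^3"
    using assms power_decreasing[of 1 2 x] power_decreasing[of 1 3 x] by auto
  have "x * (x * ((3/100) + (2/25) * x) - (1/4)) = - (1/4) * x + (3/100) * x^2 + (2/25) * x^3"
    by (simp add: algebra_simps power2_eq_square power3_eq_cube)
  then have "G x - G_approx x = (- (1/4) * x + (3/100) * x^2 + (2/25) * x^3) * (exp (- x) - exp_approx x)"
    by (simp only: G_eq G_approx_def right_diff_distrib)
  moreover have "\<bar>- (1/4) * x + (3/100) * x^2 + (2/25) * x^3\<bar> \<le> 3/10"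
    using x assms by (intro abs_leI; linarith)
  ultimately show ?thesis
    using exp_approx[OF assms] mult_mono[of "\<bar>- (1/4) * x + (3/100) * x^2 + (2/25) * x^3\<bar>" "3/10" "\<bar>exp (- x) - exp_approx x\<bar>" "1/40000"]
    by (simp add: abs_mult)
qed

lemma dG_approx:
  assumes "0 \<le> x" "x \<le> 1"
  shows "\<bar>dG x - dG_approx x\<bar> \<le> 1/100000"
proof -
  have x: "x^2 \<le> x" "x^3 \<le> x" "0 \<le> x^2" "0 \<le> x^3"
    using assms power_decreasing[of 1 2 x] power_decreasing[of 1 3 x] by auto
  have "x * ((31/100) + x * ((21/100) - (2/25) * x)) - (1/4) = - (1/4) + (31/100) * x + (21/100) * x^2 - (2/25) * x^3"
    by (simp add: algebra_simps power2_eq_square power3_eq_cube)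
  then have "dG x - dG_approx x = (- (1/4) + (31/100) * x + (21/100) * x^2 - (2/25) * x^3) * (exp (- x) - exp_approx x)"
    by (simp only: dG_def dG_approx_def right_diff_distrib)
  moreover have "\<bar>- (1/4) + (31/100) * x + (21/100) * x^2 - (2/25) * x^3\<bar> \<le> 3/10"
    using x assms by (intro abs_leI; linarith)
  ultimately show ?thesis
    using exp_approx[OF assms] mult_mono[of "\<bar>- (1/4) + (31/100) * x + (21/100) * x^2 - (2/25) * x^3\<bar>" "3/10" "\<bar>exp (- x) - exp_approx x\<bar>" "1/40000"]
    by (simp add: abs_mult)
qed

text \<open>This is the first term of the series of 2 artanh z with z = (x - 1)/(x + 1); the ratio
  1047/1000 keeps z below 23/1000, and the remainder is of order z^3.\<close>

lemma ln_near_1: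
  fixes x :: real
  assumes "1 \<le> x" "x \<le> (1047/1000)"
  shows "\<bar>ln x - 2 * ((x - 1) / (x + 1))\<bar> \<le> 9/1000000"
proof (cases "x = 1")
  case False
  then have x: "1 < x" using assms by simp
  define z where "z = (x - 1) / (x + 1)"
  have z: "0 \<le> z" "z \<le> 23/1000" using assms by (auto simp: z_def field_simps)
  have "z^3 / (1 - z\<^sup>2) \<le> (23/1000)^3 / (1 - (23/1000)\<^sup>2)"
    using z by (intro frac_le power_mono diff_mono) (auto simp: power2_eq_square intro: mult_mono)
  also have "\<dots> \<le> 13/1000000" by (simp add: power_divide)
  finally have d: "z^3 / (1 - z\<^sup>2) \<le> 13/1000000" .
  define D where "D = z^3 / (1 - z\<^sup>2)"
  have three: "2 * 1 + 1 = (3 :: nat)" by simp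
  from ln_approx_bounds[OF x, of 1, folded z_def, unfolded three of_nat_numeral atLeastAtMost_iff]
  have "2 * z \<le> ln x" "ln x \<le> 2 * z + 2 * (D / 3)" by (auto simp: D_def)
  then show ?thesis using d[folded D_def] unfolding z_def[symmetric] by (intro abs_leI; linarith)
qed simp

lemma ln_interp:
  assumes "ln_table l xs" "l \<le> x" "x \<le> 2" "0 < l"
  shows "\<bar>ln x - ln_interp xs x\<bar> \<le> 1/100000"
  using assms
proof (induction l xs rule: ln_table.induct)
  case (2 l r a e xs)
  show ?case
  proof (cases "x \<le> r")
    case True
    have a: "0 < a" "a \<le> (1047/1000) * l" "r \<le> (1047/1000) * a" "\<bar>ln a - e\<bar> \<le> 1/1000000"
      using "2.prems"(1) by auto
    have x: "0 < x" using 2 by auto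
    have "\<bar>ln x - ln a - 2 * ((x - a) / (x + a))\<bar> \<le> 9/1000000"
    proof (cases "a \<le> x")
      case True
      have "(x / a - 1) / (x / a + 1) = (x - a) / (x + a)"
        using a x by (simp add: divide_simps)
      moreover have "x / a \<le> (1047/1000)" using a \<open>x \<le> r\<close> by (simp add: divide_le_eq)
      ultimately show ?thesis
        using ln_near_1[of "x / a"] True a x by (simp add: ln_div)
    next
      case False
      have "(a / x - 1) / (a / x + 1) = - ((x - a) / (x + a))"
        using a x by (simp add: divide_simps)
      moreover have "a / x \<le> (1047/1000)"
      proof -
        have "a \<le> (1047/1000) * x" using a(2) 2(3) by linarith
        then show ?thesis using x by (simp add: divide_le_eq)
      qed
      ultimately have "\<bar>ln a - ln x + 2 * ((x - a) / (x + a))\<bar> \<le> 9/1000000"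
        using ln_near_1[of "a / x"] False a x by (simp add: ln_div)
      then show ?thesis by linarith
    qed
    moreover have "ln_interp ((r, a, e) # xs) x = e + 2 * ((x - a) / (x + a))"
      using True by simp
    ultimately show ?thesis using a(4) by linarith
  next
    case False
    then show ?thesis using 2 by simp
  qed
qed auto

text \<open>The table contributes 1/100000, and so does the rounding of ln 2, which is multiplied by
  k - 1; this is why k is bounded.\<close>

lemma ln_approx:
  assumes "(9/10) * 2^k \<le> 2 * x" "x \<le> 2^k" "k \<le> 10"
  shows "\<bar>ln x - ln_approx k x\<bar> \<le> 1/40000"
proof -
  have *: "\<bar>ln a - e\<bar> \<le> 1/1000000"
    if "\<bar>(\<Sum>k<6. 2 * ((a - 1) / (a + 1)) ^ (2*k+1) / real (2*k+1)) - e\<bar> \<le> 7/10000000" "1 < a" "a \<le> 2" for a e :: real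
  proof -
    define z where "z = (a - 1) / (a + 1)"
    have z: "0 \<le> z" "z \<le> 1/3" using that by (auto simp: z_def field_simps)
    have "z * z \<le> 1/3 * (1/3)" using z by (intro mult_mono) auto
    then have "z^13 / (1 - z\<^sup>2) \<le> (1/3)^13 / (8/9)"
      using z by (intro frac_le power_mono) (auto simp: power2_eq_square)
    also have "\<dots> \<le> 1/1000000" by (simp add: power_divide)
    finally have d: "z^13 / (1 - z\<^sup>2) \<le> 1/1000000" .
    have n: "2 * 6 + 1 = (13 :: nat)" by simp
    define D where "D = z^13 / (1 - z\<^sup>2)"
    define S where "S = (\<Sum>k<6. 2 * z ^ (2*k+1) / real (2*k+1))"
    from ln_approx_bounds[OF that(2), of 6, folded z_def, unfolded n of_nat_numeral atLeastAtMost_iff, folded S_def D_def]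
    show ?thesis using d[folded D_def] that(1)[folded z_def, folded S_def] by (intro abs_leI; linarith)
  qed
  \<comment> \<open>The series bound is for arguments above 1, so the only node below 1 is treated
    through its reciprocal.\<close>
  have 94: "\<bar>ln (47/50) - (- (99/1600))\<bar> \<le> (1/1000000 :: real)"
  proof -
    have "\<bar>ln (1/(47/50)) - (99/1600)\<bar> \<le> (1/1000000 :: real)"
      by (rule *) (simp_all add: lessThan_nat_numeral lessThan_Suc power_divide)
    moreover have "ln (1/(47/50) :: real) = - ln (47/50)" by (subst ln_div) simp_all
    ultimately show ?thesis by linarith
  qed
  have x: "0 < x" using assms(1) by (smt (verit) zero_less_power divide_pos_pos mult_pos_pos)
  define u where "u = 2 * x / 2^k"
  have u: "(9/10) \<le> u" "u \<le> 2" using assms by (auto simp: u_def field_simps)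
  have "\<bar>ln u - (ln_approx k x - (real k * (693147/1000000) - (693147/1000000)))\<bar> \<le> 1/100000"
    unfolding ln_approx_def add_diff_cancel u_def[symmetric]
  proof (rule ln_interp[OF _ u])
    show "ln_table (9/10) [((49/50), (47/50), - (99/1600)), ((53/50), (51/50), (19803/1000000)), ((23/20), (11/10), (9531/100000)),
     ((5/4), (6/5), (91161/500000)), ((34/25), (13/10), (65591/250000)), ((37/25), (71/50), (350657/1000000)), ((161/100), (77/50), (215891/500000)),
     ((7/4), (42/25), (259397/500000)), ((191/100), (183/100), (151079/250000)), ((2001/1000), (39/20), (667829/1000000))]"
      unfolding ln_table.simps
      by (intro conjI * 94) (simp_all add: lessThan_nat_numeral lessThan_Suc power_divide)
  qed simp
  moreover have ln2: "ln 2 - (693147/1000000) \<le> (1/1000000 :: real)" "0 \<le> ln 2 - ((693147/1000000) :: real)"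
    using ln_approx_bounds[of 2 7] by (simp_all add: eval_nat_numeral)
  have "\<bar>(real k - 1) * (ln 2 - (693147/1000000))\<bar> \<le> 10 * (1/1000000)"
    using assms(3) ln2 unfolding abs_mult by (intro mult_mono) auto
  moreover have "ln x = ln u + (real k - 1) * ln 2"
    using x by (simp add: u_def ln_div ln_mult_pos ln_realpow algebra_simps)
  moreover have "(real k - 1) * (ln 2 - (693147/1000000))
      = (real k - 1) * ln 2 - (real k * (693147/1000000) - (693147/1000000))"
  proof -
    have "(K - 1) * (L - r) = (K - 1) * L - (K * r - r)" for K L r :: real
      by (simp add: algebra_simps)
    then show ?thesis .
  qed
  ultimately show ?thesis by linarith
qed

lemma G_approx_le:
  assumes "0 \<le> x" "x \<le> 1"
  shows "G_approx x - 1/100000 \<le> G x" "G x \<le> G_approx x + 1/100000"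
    "dG_approx x - 1/100000 \<le> dG x" "dG x \<le> dG_approx x + 1/100000"
  using G_approx[OF assms] dG_approx[OF assms] by linarith+

lemma ln_approx_le:
  assumes "(9/10) * 2^k \<le> 2 * x" "x \<le> 2^k" "k \<le> 10"
  shows "ln_approx k x - 1/40000 \<le> ln x" "ln x \<le> ln_approx k x + 1/40000"
  using ln_approx[OF assms] by linarith+

lemma le_one_plus_ln:
  assumes "0 \<le> x"
  shows "x \<le> (1 + x) * ln (1 + x :: real)"
proof -
  have "ln (1 / (1 + x)) \<le> 1 / (1 + x) - 1" using assms by (intro ln_le_minus_one) auto
  then have "x / (1 + x) \<le> ln (1 + x)" using assms by (simp add: ln_div field_simps)
  then show ?thesis using assms by (simp add: field_simps)
qed

text \<open>Constant parameters cannot reach down to 0: the last condition of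
  \<open>admissible\<close> would force a = 0 as l tends to 0. So 1 - p, M, a and exp (- b) are
  taken proportional to l.\<close>

lemma admissible_small:
  assumes "0 < l" "l \<le> 0.01"
  shows "admissible l"
proof -
  have l: "0 < l" "l \<le> (1/100)" using assms by auto
  \<comment> \<open>257/200 lies just above exp (1/4), because dF l is about - 1/4 - ln l. To first
    order the other conditions are a \<ge> (257/200) l + M, exp (- b) \<le> a and a / l - ln (M exp
    (- b) / l^2) \<le> 3/2; the last left-hand side is 11/4 - ln (189/50), about 1.42.\<close>
  define p M a b where "p = 1 - (257/200) * l" and "M = (7/5) * l" and "a = (11/4) * l" and "b = - ln ((27/10) * l)"
  have pM: "0 < p" "p < 1" "0 < M" "M < 1" "0 \<le> a" using l by (auto simp: p_def M_def a_def)
  have b0: "0 \<le> b" using l by (simp add: b_def)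
  have ln1: "- (t / (1 - t)) \<le> ln (1 - t)" if "0 \<le> t" "t < 1" for t :: real
  proof -
    have "ln (1 / (1 - t)) \<le> 1 / (1 - t) - 1" using that by (intro ln_le_minus_one) auto
    then show ?thesis using that by (simp add: ln_div field_simps)
  qed
  have "- dF l \<le> ln (1 - p)"
  proof -
    have "- (1/4) * exp (- l) \<le> dG l"
    proof -
      have "l^3 \<le> l" using l power_decreasing[of 1 3 l] by auto
      then have "- (1/4) \<le> - (1/4) + (31/100) * l + (21/100) * l^2 - (2/25) * l^3"
        using l zero_le_power2[of l] by linarith
      then show ?thesis unfolding dG_def by (intro mult_right_mono) auto
    qed
    moreover have "(1/4) * exp (- l) \<le> (1/4) * 1" using l by (intro mult_left_mono) auto
    moreover have "(1/4) \<le> ln ((257/200) :: real)"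
      using ln_approx_le[of 1 "(257/200)"] by (simp add: ln_approx_def Let_def)
    moreover have "0 \<le> ln (1 + l)" using l by simp
    moreover have "ln (1 - p) = ln (257/200) + ln l"
    proof -
      have e: "1 - p = (257/200) * l" by (simp add: p_def)
      show ?thesis unfolding e using l by (intro ln_mult_pos) auto
    qed
    ultimately show ?thesis unfolding dF_def by linarith
  qed
  moreover have "- ln p \<le> (1 - M) * (a + ln (1 - M))"
  proof -
    have "- ln p \<le> (257/200) * l / (1 - (257/200) * l)"
      using ln1[of "(257/200) * l"] l by (simp add: p_def)
    also have "\<dots> \<le> (257/200) * l / (987/1000)"
      using l by (intro divide_left_mono) auto
    also have "\<dots> \<le> (1303/1000) * l" using l by simp
    finally have 1: "- ln p \<le> (1303/1000) * l" .
    have "M / (1 - M) \<le> M / (493/500)"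
      using l by (intro divide_left_mono) (auto simp: M_def)
    also have "\<dots> \<le> (71/50) * l" using l by (simp add: M_def)
    finally have "M / (1 - M) \<le> (71/50) * l" .
    then have "- ((71/50) * l) \<le> ln (1 - M)" using ln1[of M] pM by linarith
    then have "(1 - M) * ((133/100) * l) \<le> (1 - M) * (a + ln (1 - M))"
      using pM by (intro mult_left_mono) (auto simp: a_def)
    moreover have "(493/500) * ((133/100) * l) \<le> (1 - M) * ((133/100) * l)"
      using l by (intro mult_right_mono) (auto simp: M_def)
    moreover have "- ln p \<le> (493/500) * ((133/100) * l)" using 1 l by simp
    ultimately show ?thesis by (meson order_trans)
  qed
  moreover have "region a b"
  proof (rule region_Erdos_Szekeres)
    have "exp (- a) \<le> 1 - a + a\<^sup>2 / 2"
    proof -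
      obtain t where "exp (- a) = (\<Sum>m<3. (- a) ^ m / fact m) + exp t / fact 3 * (- a) ^ 3"
        using Maclaurin_exp_le[of "- a" 3] by auto
      moreover have "exp t / fact 3 * (- a) ^ 3 \<le> 0"
        using pM by (intro mult_nonneg_nonpos) auto
      ultimately show ?thesis by (simp add: eval_nat_numeral)
    qed
    moreover have "a\<^sup>2 \<le> (11/400) * a"
      using l by (simp add: power2_eq_square a_def mult_left_mono)
    moreover have "exp (- b) = (27/10) * l" using l by (simp add: b_def)
    ultimately show "exp (- a) + exp (- b) \<le> 1" using l by (simp add: a_def)
  qed
  moreover have "a + l * (b - ln M) \<le> 2 * F l"
  proof -
    have "(5/4) \<le> ln ((189/50) :: real)"
      using ln_approx_le[of 2 "(189/50)"] by (simp add: ln_approx_def Let_def)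
    then have "b - ln M \<le> - (5/4) - 2 * ln l"
    proof -
      have "ln ((27/10) * l) = ln (27/10) + ln l" using l by (intro ln_mult_pos) auto
      moreover have "ln ((7/5) * l) = ln (7/5) + ln l" using l by (intro ln_mult_pos) auto
      moreover have "ln ((189/50) :: real) = ln (27/10) + ln (7/5)"
        using ln_mult_pos[of "(27/10) :: real" "(7/5)"] by simp
      ultimately show ?thesis using \<open>(5/4) \<le> ln ((189/50) :: real)\<close>
        unfolding b_def M_def by linarith
    qed
    then have "a + l * (b - ln M) \<le> a + l * (- (5/4) - 2 * ln l)"
      using l by (intro add_left_mono mult_left_mono) auto
    also have "\<dots> = (3/2) * l - 2 * (l * ln l)" by (simp add: a_def algebra_simps)
    also have "\<dots> \<le> 2 * F l"
    proof -
      have "l \<le> (1 + l) * ln (1 + l)" using l by (intro le_one_plus_ln) auto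
      then show ?thesis using G_lower[OF less_imp_le[OF l(1)]] by (simp add: F_def algebra_simps)
    qed
    finally show ?thesis .
  qed
  ultimately show ?thesis unfolding admissible_def using pM b0 by blast
qed

text \<open>The place where a k + b l touches the exponent: at l/k = y for \<open>Lower\<close>, at
  k/l = y for \<open>Upper\<close>, at the kink k = l for \<open>Corner\<close>.\<close>

datatype tangency = Lower | Upper | Corner

definition check_region :: "tangency \<Rightarrow> real \<Rightarrow> nat \<Rightarrow> real \<Rightarrow> real \<Rightarrow> bool" where
  "check_region t y k a b \<longleftrightarrow> 0 < y \<and> y \<le> 1 \<and> k \<le> 10 \<and> (case t of
     Corner \<Rightarrow> G_approx 1 + 2 * ln_approx 1 2 + 1/10000 \<le> a + b \<and>
       a \<le> dG_approx 1 + ln_approx 1 2 - 1/10000 \<and> b \<le> dG_approx 1 + ln_approx 1 2 - 1/10000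
   | _ \<Rightarrow> (let c = (if t = Lower then a else b); d = (if t = Lower then b else a) in
       (9/10) * 2^k \<le> 2 * ((1 + y) / y) \<and> (1 + y) / y \<le> 2^k \<and> c \<le> d \<and>
       G_approx y - y * dG_approx y + ln_approx 1 (1 + y) + 1/10000 \<le> c \<and>
       dG_approx y + ln_approx k ((1 + y) / y) + 1/10000 \<le> d))"

text \<open>The terms ln M and - 2 ln l are merged into one logarithm. The factor 4 makes its
  argument large enough for a nonnegative binary exponent; 2 ln 2 is subtracted again.\<close>

definition check_end :: "real \<Rightarrow> nat \<Rightarrow> real \<Rightarrow> real \<Rightarrow> real \<Rightarrow> bool" where
  "check_end l k M a b \<longleftrightarrow> k \<le> 10 \<and> (9/10) * 2^k \<le> 2 * (4 * M / (l * l)) \<and> 4 * M / (l * l) \<le> 2^k \<and>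
     a + l * b + 2/10000 \<le> 2 * G_approx l + 2 * (1 + l) * ln_approx 1 (1 + l)
       + l * (ln_approx k (4 * M / (l * l)) - 2 * (693147/1000000))"

text \<open>These conditions are tested at the right end of an interval only, because
  \<open>dF\<close> decreases. The combined argument (1 - p)(1 + l)/l stays between 9/10 and 2, so
  the binary exponent 1 always fits; the margins 1/10000 exceed the approximation errors.\<close>

definition check_row :: "real \<Rightarrow> real \<Rightarrow> real \<Rightarrow> real \<Rightarrow> bool" where
  "check_row l p M a \<longleftrightarrow> 1/2 \<le> p \<and> p < 1 \<and> 0 < M \<and> M \<le> 1/2 \<and> 0 \<le> a \<and>
     (9/10) * 2^1 \<le> 2 * ((1 - p) * ((1 + l) / l)) \<and> (1 - p) * ((1 + l) / l) \<le> 2^1 \<and>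
     1/10000 \<le> dG_approx l + ln_approx 1 ((1 - p) * ((1 + l) / l)) \<and>
     1/10000 \<le> (1 - M) * (a + ln_approx 0 (1 - M)) + ln_approx 0 p"

type_synonym row = "real \<times> nat \<times> nat \<times> real \<times> real \<times> real \<times> real \<times> tangency \<times> real \<times> nat"

text \<open>Each row \<open>(l', k, k', p, M, a, b, t, y, j)\<close> treats the interval from the end \<open>l\<close> of the
  previous one to \<open>l'\<close>; \<open>(a, b)\<close> is read off the tangent of \<open>F\<close> at \<open>y\<close>, and \<open>k, k', j\<close> are the
  binary exponents for the logarithms.\<close>

fun covers :: "real \<Rightarrow> row list \<Rightarrow> real \<Rightarrow> bool" where
  "covers l [] r \<longleftrightarrow> l = r"
| "covers l ((l', k, k', p, M, a, b, t, y, j) # rs) r \<longleftrightarrow>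
     l \<le> l' \<and> l' \<le> 1 \<and> 0 \<le> b \<and> check_row l' p M a \<and> check_region t y j a b \<and>
     check_end l k M a b \<and> check_end l' k' M a b \<and> covers l' rs r"

lemma check_region:
  assumes "check_region t y k a b"
  shows "region a b"
proof (cases t)
  case Corner
  have "F 1 = G 1 + 2 * ln 2" "dF 1 = dG 1 + ln 2" by (auto simp: F_def dF_def)
  then show ?thesis
    using assms Corner ln_approx_le[of 1 2] G_approx_le[of 1]
    by (intro region_corner) (auto simp: check_region_def)
next
  have *: "region c d"
    if "0 < y" "y \<le> 1" "k \<le> 10" "(9/10) * 2^k \<le> 2 * ((1 + y) / y)" "(1 + y) / y \<le> 2^k" "c \<le> d"
      "G_approx y - y * dG_approx y + ln_approx 1 (1 + y) + 1/10000 \<le> c"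
      "dG_approx y + ln_approx k ((1 + y) / y) + 1/10000 \<le> d" for c d
  proof (rule region_tangent[OF that(1,2) _ _ that(6)])
    note G = G_approx_le[OF less_imp_le[OF that(1)] that(2)]
    have "y * (dG_approx y - 1/100000) \<le> y * dG y"
      using G that by (intro mult_left_mono) auto
    then have "y * dG_approx y - y * dG y \<le> 1/100000"
      using that by (simp add: algebra_simps)
    moreover have "ln (1 + y) \<le> ln_approx 1 (1 + y) + 1/40000"
      using that by (intro ln_approx_le) auto
    moreover have "F y - y * dF y = G y - y * dG y + ln (1 + y)"
      by (simp add: F_def dF_def algebra_simps)
    ultimately show "F y - y * dF y \<le> c" using G(2) that(7) by linarith
    have "ln ((1 + y) / y) \<le> ln_approx k ((1 + y) / y) + 1/40000"
      using that by (intro ln_approx_le) auto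
    moreover have "ln ((1 + y) / y) = ln (1 + y) - ln y" using that by (simp add: ln_div)
    ultimately show "dF y \<le> d" using G(4) that(8) unfolding dF_def by linarith
  qed
  {
    case Lower
    then show ?thesis using assms by (intro *) (auto simp: check_region_def)
  next
    case Upper
    then have "region b a" using assms by (intro *) (auto simp: check_region_def)
    then show ?thesis by (simp add: region_commute)
  }
qed

lemma check_end:
  assumes "check_end l k M a b" "0 < l" "l \<le> 1" "0 < M"
  shows "a + l * (b - ln M) \<le> 2 * F l"
proof -
  have 1: "ln_approx k (4 * M / (l * l)) - 1/40000 \<le> ln (4 * M / (l * l))"
    using assms by (intro ln_approx_le) (auto simp: check_end_def)
  have "ln (4 * M / (l * l)) = 2 * ln 2 + ln M - 2 * ln l"
  proof -
    have "ln (4 :: real) = 2 * ln 2" using ln_realpow[of 2 2] by simp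
    then show ?thesis using assms by (simp add: ln_div ln_mult_pos)
  qed
  moreover have "ln 2 \<le> ((173287/250000) :: real)"
    using ln_approx_bounds[of 2 7] by (simp add: eval_nat_numeral)
  ultimately have "ln_approx k (4 * M / (l * l)) - 2 * (693147/1000000) - 1/20000 \<le> ln M - 2 * ln l"
    using 1 by simp
  then have "l * (ln_approx k (4 * M / (l * l)) - 2 * (693147/1000000) - 1/20000) \<le> l * (ln M - 2 * ln l)"
    using assms by (intro mult_left_mono) auto
  then have A: "l * (ln_approx k (4 * M / (l * l)) - 2 * (693147/1000000)) - 1/20000 \<le> l * ln M - 2 * (l * ln l)"
    using assms by (simp add: algebra_simps)
  have "ln_approx 1 (1 + l) - 1/40000 \<le> ln (1 + l)"
    using assms by (intro ln_approx_le) auto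
  then have "2 * (1 + l) * (ln_approx 1 (1 + l) - 1/40000) \<le> 2 * (1 + l) * ln (1 + l)"
    using assms by (intro mult_left_mono) auto
  moreover have "2 * (1 + l) * (1/40000) \<le> 1/10000" using assms by simp
  ultimately have B: "2 * (1 + l) * ln_approx 1 (1 + l) - 1/10000 \<le> 2 * ((1 + l) * ln (1 + l))"
    unfolding right_diff_distrib mult.assoc by linarith
  have C: "G_approx l - 1/100000 \<le> G l" using G_approx_le[of l] assms by simp
  have "a + l * b + 2/10000 \<le> 2 * G_approx l + 2 * (1 + l) * ln_approx 1 (1 + l)
       + l * (ln_approx k (4 * M / (l * l)) - 2 * (693147/1000000))"
    using assms(1) by (simp add: check_end_def)
  then have "a + l * b \<le> 2 * G l + 2 * ((1 + l) * ln (1 + l)) + l * ln M - 2 * (l * ln l)"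
    using A B C by linarith
  then show ?thesis by (simp add: F_def algebra_simps)
qed

lemma check_row:
  assumes "check_row l p M a" "0 < l" "l \<le> 1"
  shows "- dF l \<le> ln (1 - p)" "- ln p \<le> (1 - M) * (a + ln (1 - M))"
proof -
  note A = assms(1)[unfolded check_row_def]
  have "ln_approx 1 ((1 - p) * ((1 + l) / l)) - 1/40000 \<le> ln ((1 - p) * ((1 + l) / l))"
    by (rule ln_approx_le) (use A in blast, use A in blast, simp)
  moreover have "ln ((1 - p) * ((1 + l) / l)) = ln (1 - p) + (ln (1 + l) - ln l)"
    using A assms by (simp add: ln_mult_pos ln_div)
  moreover have "dG_approx l - 1/100000 \<le> dG l" using G_approx_le[of l] assms by simp
  ultimately show "- dF l \<le> ln (1 - p)" using A unfolding dF_def by linarith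
  have "ln_approx 0 (1 - M) - 1/40000 \<le> ln (1 - M)" "ln_approx 0 p - 1/40000 \<le> ln p"
    using A by (intro ln_approx_le; auto)+
  moreover from this(1) have "(1 - M) * (a + (ln_approx 0 (1 - M) - 1/40000)) \<le> (1 - M) * (a + ln (1 - M))"
    using A by (intro mult_left_mono) auto
  moreover have "(1 - M) * (a + (ln_approx 0 (1 - M) - 1/40000))
      = (1 - M) * (a + ln_approx 0 (1 - M)) - 1/40000 + M * (1/40000)"
  proof -
    have "(1 - M) * (a + (x - e)) = (1 - M) * (a + x) - e + M * e" for x e :: real
      by (simp add: algebra_simps)
    then show ?thesis .
  qed
  ultimately show "- ln p \<le> (1 - M) * (a + ln (1 - M))" using A by linarith
qed

lemma admissible_between:
  assumes l: "0 < l1" "l1 \<le> l" "l \<le> l2" "l2 \<le> 1"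
    and pM: "0 < p" "p < 1" "0 < M" "M < 1" "0 \<le> a" "0 \<le> b" "region a b"
    and p: "- dF l2 \<le> ln (1 - p)" "- ln p \<le> (1 - M) * (a + ln (1 - M))"
    and ends: "a + l1 * (b - ln M) \<le> 2 * F l1" "a + l2 * (b - ln M) \<le> 2 * F l2"
  shows "admissible l"
proof -
  have "- dF l \<le> ln (1 - p)" using dF_antimono[of l l2] l p by simp
  moreover have "a + l * (b - ln M) \<le> 2 * F l"
  proof (cases "l1 = l2")
    case False
    define t where "t = (l - l1) / (l2 - l1)"
    have "t * (l2 - l1) = l - l1" using False by (simp add: t_def)
    then have t3: "l = (1 - t) * l1 + t * l2" by (simp add: algebra_simps)
    have "0 \<le> t" "t \<le> 1" using l False by (auto simp: t_def)
    note t = this t3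
    have "(1 - t) * F l1 + t * F l2 \<le> F l"
      using concave_onD[OF concave_F t(1,2), of l1 l2] l t(3) by simp
    moreover have "(1 - t) * (a + l1 * (b - ln M)) + t * (a + l2 * (b - ln M))
        \<le> (1 - t) * (2 * F l1) + t * (2 * F l2)"
      using t ends by (intro add_mono mult_left_mono) auto
    moreover have "(1 - t) * (a + l1 * (b - ln M)) + t * (a + l2 * (b - ln M)) = a + l * (b - ln M)"
      unfolding t(3) by (simp add: algebra_simps)
    ultimately show ?thesis by simp
  qed (use l ends in auto)
  ultimately show ?thesis unfolding admissible_def using pM p by blast
qed

lemma covers_admissible:
  assumes "covers l0 rs r" "0 < l0" "l0 \<le> l" "l \<le> r" "l0 < l \<or> admissible l0"
  shows "admissible l"
  using assms
proof (induction l0 rs r rule: covers.induct)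
  case (1 l0 r)
  then show ?case by (metis covers.simps(1) order.antisym not_less)
next
  case (2 l0 l' k k' p M a b t y j rs r)
  have c: "l0 \<le> l'" "l' \<le> 1" "0 \<le> b" "check_row l' p M a" "check_region t y j a b"
    "check_end l0 k M a b" "check_end l' k' M a b" "covers l' rs r"
    using "2.prems"(1) by auto
  have pM: "0 < p" "p < 1" "0 < M" "M < 1" "0 \<le> a" using c(4) by (auto simp: check_row_def)
  have 1: "admissible x" if "l0 \<le> x" "x \<le> l'" for x
    using that c pM "2.prems"(2) check_row[of l' p M a] check_region[OF c(5)]
      check_end[OF c(6)] check_end[OF c(7)]
    by (intro admissible_between[of l0 x l' p M a b]) auto
  show ?case
  proof (cases "l \<le> l'")
    case True
    then show ?thesis using 1 "2.prems" by auto
  next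
    case False
    then show ?thesis using "2.IH"[OF c(8)] 1[of l'] c "2.prems" by auto
  qed
qed

section \<open>The parameter tables, in blocks\<close>

lemmas checker_defs = check_row_def check_region_def check_end_def G_approx_def dG_approx_def
  exp_approx_def ln_approx_def Let_def

text \<open>In each row M is the real choice. The condition on \<open>dF\<close> limits p to 1 - exp
  (- dF l'), then a is at least - ln p / (1 - M) - ln (1 - M), and the tangents of F determine how
  small b can be.\<close>

lemma covers_0: "covers 0.01
  [(0.0134, 9, 8, 0.9831, 0.011, 0.0285, 3.3352, Lower, 0.029, 6),
   (0.0183, 9, 8, 0.9771, 0.016, 0.0399, 3.0071, Lower, 0.041, 5),
   (0.0254, 9, 8, 0.9686, 0.026, 0.0593, 2.6248, Lower, 0.062, 5),
   (0.035, 8, 7, 0.9573, 0.033, 0.0789, 2.3532, Lower, 0.084, 4),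
   (0.0481, 8, 7, 0.9426, 0.045, 0.1081, 2.0616, Lower, 0.118, 4),
   (0.0651, 7, 6, 0.9242, 0.058, 0.1436, 1.8049, Lower, 0.162, 3),
   (0.0862, 7, 6, 0.9027, 0.076, 0.19, 1.5618, Lower, 0.224, 3),
   (0.1094, 6, 6, 0.8805, 0.104, 0.252, 1.3294, Lower, 0.316, 3)] 0.1094"
  by (simp add: checker_defs)

lemma covers_8: "covers 0.1094
  [(0.137, 6, 5, 0.856, 0.12, 0.3047, 1.1819, Lower, 0.404, 2),
   (0.1662, 5, 5, 0.8321, 0.134, 0.3563, 1.0669, Lower, 0.5, 2),
   (0.1948, 5, 4, 0.8105, 0.148, 0.407, 0.9748, Lower, 0.604, 2),
   (0.2212, 5, 4, 0.792, 0.172, 0.4706, 0.8802, Lower, 0.748, 2),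
   (0.2432, 4, 4, 0.7776, 0.182, 0.5086, 0.8323, Lower, 0.84, 2),
   (0.2623, 4, 4, 0.7657, 0.19, 0.5405, 0.7959, Lower, 0.92, 2),
   (0.278, 4, 4, 0.7564, 0.206, 0.5825, 0.7524, Corner, 1, 0),
   (0.2912, 4, 4, 0.7488, 0.218, 0.616, 0.7189, Corner, 1, 0)] 0.2912"
  by (simp add: checker_defs)

lemma covers_16: "covers 0.2912
  [(0.3024, 4, 4, 0.7426, 0.228, 0.6446, 0.6903, Corner, 1, 0),
   (0.3125, 4, 4, 0.7371, 0.238, 0.6723, 0.6626, Corner, 1, 0),
   (0.3218, 4, 4, 0.7322, 0.242, 0.6885, 0.6464, Corner, 1, 0),
   (0.3311, 4, 4, 0.7274, 0.246, 0.7047, 0.6302, Corner, 1, 0),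
   (0.3404, 4, 4, 0.7227, 0.254, 0.7286, 0.6063, Corner, 1, 0),
   (0.3501, 4, 4, 0.7179, 0.266, 0.761, 0.5739, Corner, 1, 0),
   (0.3603, 4, 4, 0.713, 0.272, 0.7824, 0.5531, Upper, 0.952, 2),
   (0.3713, 4, 3, 0.7078, 0.272, 0.7925, 0.5437, Upper, 0.928, 2)] 0.3713"
  by (simp add: checker_defs)

lemma covers_24: "covers 0.3713
  [(0.3829, 3, 3, 0.7025, 0.272, 0.8028, 0.5342, Upper, 0.904, 2),
   (0.3955, 3, 3, 0.6969, 0.28, 0.8303, 0.5102, Upper, 0.844, 2),
   (0.4089, 3, 3, 0.6911, 0.282, 0.8461, 0.4972, Upper, 0.812, 2),
   (0.4217, 3, 3, 0.6857, 0.272, 0.8361, 0.5053, Upper, 0.832, 2),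
   (0.4364, 3, 3, 0.6797, 0.286, 0.8779, 0.4723, Upper, 0.752, 2),
   (0.4519, 3, 3, 0.6736, 0.292, 0.9036, 0.4535, Upper, 0.708, 2),
   (0.4673, 3, 3, 0.6677, 0.292, 0.9161, 0.4448, Upper, 0.688, 2),
   (0.4838, 3, 3, 0.6616, 0.298, 0.9426, 0.4271, Upper, 0.648, 2)] 0.4838"
  by (simp add: checker_defs)

lemma covers_32: "covers 0.4838
  [(0.5001, 3, 3, 0.6558, 0.3, 0.9597, 0.4162, Upper, 0.624, 2),
   (0.5168, 3, 3, 0.65, 0.312, 1.0004, 0.3919, Upper, 0.572, 2),
   (0.5338, 3, 3, 0.6443, 0.308, 1.0038, 0.39, Upper, 0.568, 2),
   (0.5514, 3, 3, 0.6386, 0.316, 1.0357, 0.3724, Upper, 0.532, 2),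
   (0.5699, 3, 2, 0.6328, 0.32, 1.0588, 0.3604, Upper, 0.508, 2),
   (0.588, 2, 2, 0.6273, 0.318, 1.0669, 0.3563, Upper, 0.5, 2),
   (0.6064, 2, 2, 0.6219, 0.318, 1.0794, 0.3502, Upper, 0.488, 2),
   (0.6247, 2, 2, 0.6167, 0.32, 1.0968, 0.3418, Upper, 0.472, 2)] 0.6247"
  by (simp add: checker_defs)

lemma covers_40: "covers 0.6247
  [(0.6438, 2, 2, 0.6114, 0.324, 1.1198, 0.3312, Upper, 0.452, 2),
   (0.6602, 2, 2, 0.607, 0.35, 1.1991, 0.2978, Upper, 0.392, 2),
   (0.6782, 2, 2, 0.6023, 0.35, 1.211, 0.2932, Upper, 0.384, 2),
   (0.6971, 2, 2, 0.5975, 0.35, 1.2233, 0.2885, Upper, 0.376, 2),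
   (0.7169, 2, 2, 0.5926, 0.35, 1.236, 0.2838, Upper, 0.368, 2),
   (0.7376, 2, 2, 0.5876, 0.35, 1.2491, 0.279, Upper, 0.36, 2),
   (0.7577, 2, 2, 0.5829, 0.348, 1.2558, 0.2766, Upper, 0.356, 2),
   (0.7783, 2, 2, 0.5782, 0.356, 1.291, 0.2644, Upper, 0.336, 2)] 0.7783"
  by (simp add: checker_defs)

lemma covers_48: "covers 0.7783
  [(0.7972, 2, 2, 0.574, 0.352, 1.291, 0.2644, Upper, 0.336, 2),
   (0.8165, 2, 2, 0.5698, 0.364, 1.3374, 0.2494, Upper, 0.312, 3),
   (0.8348, 2, 2, 0.5659, 0.366, 1.354, 0.2443, Upper, 0.304, 3),
   (0.8539, 2, 2, 0.5619, 0.368, 1.3713, 0.2391, Upper, 0.296, 3),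
   (0.87, 1, 1, 0.5586, 0.362, 1.3626, 0.2417, Upper, 0.3, 3),
   (0.8864, 2, 1, 0.5553, 0.38, 1.4271, 0.2233, Upper, 0.272, 3),
   (0.9035, 1, 1, 0.5519, 0.38, 1.437, 0.2206, Upper, 0.268, 3),
   (0.9215, 1, 1, 0.5484, 0.38, 1.4472, 0.2179, Upper, 0.264, 3)] 0.9215"
  by (simp add: checker_defs)

lemma covers_56: "covers 0.9215
  [(0.9366, 1, 1, 0.5455, 0.374, 1.437, 0.2206, Upper, 0.268, 3),
   (0.9513, 1, 1, 0.5427, 0.388, 1.49, 0.2069, Upper, 0.248, 3),
   (0.9662, 1, 1, 0.5399, 0.382, 1.479, 0.2097, Upper, 0.252, 3),
   (0.9803, 1, 1, 0.5373, 0.39, 1.5129, 0.2014, Upper, 0.24, 3),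
   (0.9917, 1, 1, 0.5352, 0.388, 1.5129, 0.2014, Upper, 0.24, 3),
   (1, 1, 1, 0.5335, 0.39, 1.5247, 0.1986, Upper, 0.236, 3)] 1"
  by (simp add: checker_defs)

lemma admissible_unit_interval:
  assumes "0 < l" "l \<le> 1"
  shows "admissible l"
proof -
  have step: "admissible x" if "covers l0 rs r" "\<And>x. 0 < x \<Longrightarrow> x \<le> l0 \<Longrightarrow> admissible x" "0 < l0" "0 < x" "x \<le> r" for l0 rs r x
    using covers_admissible[OF that(1,3)] that(2-5) by (metis linorder_linear order_refl)
  have s0: "admissible x" if "0 < x" "x \<le> 0.1094" for x
    by (rule step[OF covers_0 admissible_small _ that]) (use that in simp_all)
  have s1: "admissible x" if "0 < x" "x \<le> 0.2912" for x
    by (rule step[OF covers_8 s0 _ that]) (use that in simp_all)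
  have s2: "admissible x" if "0 < x" "x \<le> 0.3713" for x
    by (rule step[OF covers_16 s1 _ that]) (use that in simp_all)
  have s3: "admissible x" if "0 < x" "x \<le> 0.4838" for x
    by (rule step[OF covers_24 s2 _ that]) (use that in simp_all)
  have s4: "admissible x" if "0 < x" "x \<le> 0.6247" for x
    by (rule step[OF covers_32 s3 _ that]) (use that in simp_all)
  have s5: "admissible x" if "0 < x" "x \<le> 0.7783" for x
    by (rule step[OF covers_40 s4 _ that]) (use that in simp_all)
  have s6: "admissible x" if "0 < x" "x \<le> 0.9215" for x
    by (rule step[OF covers_48 s5 _ that]) (use that in simp_all)
  have s7: "admissible x" if "0 < x" "x \<le> 1" for x
    by (rule step[OF covers_56 s6 _ that]) (use that in simp_all)
  from s7[OF assms] show ?thesis .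
qed

section \<open>Induction on the clique sizes\<close>

text \<open>The ratio of consecutive terms in the expansion of (l + k)^(k + l) is (k + l - j) l /
  ((j + 1) k); it is at least 1 before j = l and at most 1 from there on.\<close>

lemma binomial_max_term:
  fixes j k l :: nat
  assumes "j \<le> k + l" "1 \<le> k" "1 \<le> l"
  shows "real ((k + l) choose j) * real l ^ j * real k ^ (k + l - j) \<le> real ((k + l) choose l) * real l ^ l * real k ^ k"
proof -
  define T where "T j = real ((k + l) choose j) * real l ^ j * real k ^ (k + l - j)" for j
  have step: "real (Suc j) * real k * T (Suc j) = real (k + l - j) * real l * T j" if "j < k + l" for j
  proof -
    have "real (Suc j) * real ((k + l) choose Suc j) = real (k + l - j) * real ((k + l) choose j)"
      by (metis binomial_absorb_comp binomial_absorption of_nat_mult mult.commute Suc_times_binomial_add binomial_absorption)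
    moreover have "real k ^ (k + l - j) = real k * real k ^ (k + l - Suc j)"
      using that by (metis Suc_diff_Suc power_Suc)
    ultimately show ?thesis unfolding T_def by (simp add: mult_ac)
  qed
  have T0: "0 \<le> T j" for j by (simp add: T_def)
  have up: "T j \<le> T (Suc j)" if "j < l" for j
  proof -
    have "real (Suc j) * real k \<le> real (k + l - j) * real l"
    proof -
      have "Suc j * k \<le> l * (k + l - j)" using that by (intro mult_le_mono) auto
      then show ?thesis by (metis of_nat_le_iff of_nat_mult mult.commute)
    qed
    then have "real (Suc j) * real k * T j \<le> real (Suc j) * real k * T (Suc j)"
      using step[of j] that T0[of j] by (simp add: mult_right_mono)
    then show ?thesis using assms by simp
  qed
  have down: "T (Suc j) \<le> T j" if "l \<le> j" "j < k + l" for j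
  proof -
    have "real (k + l - j) * real l \<le> real (Suc j) * real k"
    proof -
      have "(k + l - j) * l \<le> k * Suc j" using that by (intro mult_le_mono) auto
      then show ?thesis by (metis of_nat_le_iff of_nat_mult mult.commute)
    qed
    then have "real (Suc j) * real k * T (Suc j) \<le> real (Suc j) * real k * T j"
      using step[of j] that T0[of j] by (simp add: mult_right_mono)
    then show ?thesis using assms by simp
  qed
  have "T j \<le> T l"
  proof (cases "j \<le> l")
    case True
    then show ?thesis by (induction j rule: inc_induct) (auto intro: order_trans up)
  next
    case False
    then have "l \<le> j" by simp
    then show ?thesis using assms(1)
    proof (induction j rule: dec_induct)
      case (step n)
      then show ?case using down[of n] by simp
    qed simp
  qed
  then show ?thesis by (simp add: T_def)
qed

text \<open>k F0(l/k) is k + l times the binary entropy, in natural logarithms, of l/(k +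
  l).\<close>

definition F0 :: "real \<Rightarrow> real" where
  "F0 x = (1 + x) * ln (1 + x) - x * ln x"

lemma exp_F0:
  assumes "1 \<le> k" "1 \<le> l"
  shows "exp (real k * F0 (real l / real k)) * (real l ^ l * real k ^ k) = real (k + l) ^ (k + l)"
proof -
  have pos: "0 < real k" "0 < real l" using assms by auto
  have "1 + real l / real k = real (k + l) / real k" using pos by (simp add: field_simps)
  then have "real k * F0 (real l / real k)
     = real k * ((real (k + l) / real k) * (ln (real (k + l)) - ln (real k)))
       - real k * ((real l / real k) * (ln (real l) - ln (real k)))"
    using pos by (simp add: F0_def ln_div right_diff_distrib)
  also have "\<dots> = real (k + l) * (ln (real (k + l)) - ln (real k)) - real l * (ln (real l) - ln (real k))"
    using pos by simp
  also have "\<dots> = real (k + l) * ln (real (k + l)) - real k * ln (real k) - real l * ln (real l)"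
    by (simp add: algebra_simps)
  finally have "exp (real k * F0 (real l / real k))
     = exp (real (k + l) * ln (real (k + l))) / exp (real k * ln (real k)) / exp (real l * ln (real l))"
    by (simp add: exp_diff)
  moreover have e: "exp (real n * ln (real n)) = real n ^ n" if "1 \<le> n" for n
    using that by (simp add: exp_of_nat_mult)
  ultimately show ?thesis using assms e[of k] e[of l] e[of "k + l"] pos by simp
qed

text \<open>The term j = l is the largest of the k + l + 1 terms of (l + k)^(k + l), so it lies
  between their sum divided by k + l + 1 and their sum.\<close>

lemma choose_bounds:
  assumes "1 \<le> k" "1 \<le> l"
  shows "real ((k + l) choose l) \<le> exp (real k * F0 (real l / real k))"
    and "exp (real k * F0 (real l / real k)) \<le> real (k + l + 1) * real ((k + l) choose l)"
proof -
  define D where "D = real l ^ l * real k ^ k"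
  have D: "0 < D" using assms by (simp add: D_def)
  have bin: "real (k + l) ^ (k + l) = (\<Sum>j\<le>k+l. real ((k + l) choose j) * real l ^ j * real k ^ (k + l - j))"
    using binomial_ring[of "real l" "real k" "k + l"] by (simp add: add.commute)
  have "real ((k + l) choose l) * real l ^ l * real k ^ (k + l - l) \<le> real (k + l) ^ (k + l)"
    unfolding bin by (rule member_le_sum) auto
  then have "real ((k + l) choose l) * D \<le> exp (real k * F0 (real l / real k)) * D"
    using exp_F0[OF assms] by (simp add: D_def mult_ac)
  then show "real ((k + l) choose l) \<le> exp (real k * F0 (real l / real k))" using D by simp
  have "real (k + l) ^ (k + l) \<le> (\<Sum>j\<le>k+l. real ((k + l) choose l) * real l ^ l * real k ^ k)"
    unfolding bin using assms by (intro sum_mono binomial_max_term) auto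
  also have "\<dots> = real (k + l + 1) * real ((k + l) choose l) * D"
    by (simp add: D_def algebra_simps)
  finally have "exp (real k * F0 (real l / real k)) * D \<le> real (k + l + 1) * real ((k + l) choose l) * D"
    using exp_F0[OF assms] by (simp add: D_def)
  then show "exp (real k * F0 (real l / real k)) \<le> real (k + l + 1) * real ((k + l) choose l)"
    using D by simp
qed

lemma F_eq: "F x = G x + F0 x"
  by (simp add: F_def F0_def)

lemma F_nonneg:
  assumes "0 < x" "x \<le> 1"
  shows "0 \<le> F x"
proof -
  have "x \<le> (1 + x) * ln (1 + x)" using assms by (intro le_one_plus_ln) auto
  moreover have "x * ln x \<le> 0" using assms by (simp add: mult_nonneg_nonpos)
  ultimately show ?thesis using G_lower[OF less_imp_le[OF assms(1)]] assms by (simp add: F_def algebra_simps)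
qed

lemma eventually_log_linear:
  fixes A s e :: real
  assumes "0 < e"
  obtains K where "\<And>k. K \<le> k \<Longrightarrow> A + s * ln (real k) \<le> e * real k"
proof -
  have "(\<lambda>k. A / real k + s * (ln (real k) / real k)) \<longlonglongrightarrow> 0 + s * 0"
    by (intro tendsto_add tendsto_mult tendsto_const lim_ln_over_n lim_const_over_n)
  then have "eventually (\<lambda>k. A / real k + s * (ln (real k) / real k) < e) sequentially"
    using assms by (intro order_tendstoD) auto
  then obtain K where K: "\<And>k. K \<le> k \<Longrightarrow> A / real k + s * (ln (real k) / real k) < e"
    unfolding eventually_sequentially by blast
  show thesis
  proof (rule that[of "max 1 K"])
    fix k assume k: "max 1 K \<le> k"
    then have "(A / real k + s * (ln (real k) / real k)) * real k \<le> e * real k"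
      using K[of k] by (intro mult_right_mono) auto
    moreover have "(A / real k + s * (ln (real k) / real k)) * real k = A + s * ln (real k)"
      using k by (simp add: field_simps)
    ultimately show "A + s * ln (real k) \<le> e * real k" by simp
  qed
qed

text \<open>Keeping \<alpha>^c = exp (- u) and \<gamma>^c = exp v fixed, the weighted mean of
  \<alpha> and \<gamma> is f(1/c). Here f(0) = 1, and the hypothesis says exactly that f'(0) < 0;
  hence the mean is below 1 for large c.\<close>

lemma step_parameters:
  fixes p M a :: real
  assumes "0 < p" "p < 1" "0 < M" "M < 1" and lt: "- ln p < (1 - M) * (a + ln (1 - M))"
  obtains c :: nat and \<alpha> \<gamma> \<eta> where "2 \<le> c" "0 < \<alpha>" "\<alpha> \<le> \<gamma>" "0 < \<eta>"
    "(1 - M) * \<alpha> + M * \<gamma> < 1 - \<eta>" "exp (- a) / p \<le> \<alpha> ^ c * (1 - M)" "1 / p \<le> \<gamma> ^ c"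
proof -
  define u v where "u = a + ln p + ln (1 - M)" and "v = - ln p"
  define f where "f s = (1 - M) * exp (- u * s) + M * exp (v * s)" for s
  have v: "0 < v" using assms by (simp add: v_def)
  have "0 < (1 - M) * (a + ln (1 - M))" using lt v by (simp add: v_def)
  then have uv: "- u < v" using assms by (simp add: u_def v_def zero_less_mult_iff)
  have "DERIV f 0 :> (1 - M) * (- u) + M * v"
    unfolding f_def by (auto intro!: derivative_eq_intros)
  moreover have "(1 - M) * (- u) + M * v < 0"
    using lt by (simp add: u_def v_def algebra_simps)
  ultimately obtain d where d: "0 < d" "\<And>h. 0 < h \<Longrightarrow> h < d \<Longrightarrow> f (0 + h) < f 0"
    using DERIV_neg_dec_right by blast
  obtain c where c: "1 / d < real c" using reals_Archimedean2 by blast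
  define C where "C = max 2 c"
  have C: "2 \<le> C" "0 < real C" "1 / d < real C" using c by (auto simp: C_def)
  have f1: "f (1 / real C) < 1"
    using d(2)[of "1 / real C"] C d(1) by (simp add: f_def field_simps)
  show thesis
  proof (rule that[of C "exp (- u / real C)" "exp (v / real C)" "(1 - f (1 / real C)) / 2"])
    have "- u / real C \<le> v / real C" using uv by (intro divide_right_mono) auto
    then show "exp (- u / real C) \<le> exp (v / real C)" by (simp only: exp_le_cancel_iff)
    show "0 < (1 - f (1 / real C)) / 2" using f1 by simp
    show "(1 - M) * exp (- u / real C) + M * exp (v / real C) < 1 - (1 - f (1 / real C)) / 2"
    proof -
      have "f (1 / real C) < 1 - (1 - f (1 / real C)) / 2" using f1 by (simp add: field_simps)
      moreover have "(1 - M) * exp (- u / real C) + M * exp (v / real C) = f (1 / real C)"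
        by (simp add: f_def)
      ultimately show ?thesis by (simp only:)
    qed
    have "exp (- u / real C) ^ C = exp (- u)" using C by (simp flip: exp_of_nat_mult)
    then show "exp (- a) / p \<le> exp (- u / real C) ^ C * (1 - M)"
      using assms by (simp add: u_def exp_add exp_minus exp_diff field_simps)
    have "exp (v / real C) ^ C = exp v" using C by (simp flip: exp_of_nat_mult)
    then show "1 / p \<le> exp (v / real C) ^ C"
      using assms by (simp add: v_def exp_minus inverse_eq_divide)
  qed (use C in auto)
qed

section \<open>The induction hypothesis and its use for Y and for the red degrees\<close>

definition exponent :: "nat \<Rightarrow> nat \<Rightarrow> real" where
  "exponent k l = (if l \<le> k then real k * F (real l / real k) else real l * F (real k / real l))"

lemma exponent_le:
  assumes "region a b" "1 \<le> k" "1 \<le> l"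
  shows "exponent k l \<le> a * real k + b * real l"
proof (cases "l \<le> k")
  case True
  have "real l / real k \<in> {0<..1}" using assms True by (auto simp: divide_le_eq)
  then have "F (real l / real k) \<le> a + real l / real k * b"
    using assms(1) unfolding region_def by blast
  then have "real k * F (real l / real k) \<le> real k * (a + real l / real k * b)"
    by (intro mult_left_mono) auto
  also have "\<dots> = a * real k + b * real l" using assms by (simp add: field_simps)
  finally show ?thesis using True by (simp add: exponent_def)
next
  case False
  have "real k / real l \<in> {0<..1}" using assms False by (auto simp: divide_le_eq)
  then have "F (real k / real l) \<le> b + real k / real l * a"
    using assms(1) unfolding region_def by blast
  then have "real l * F (real k / real l) \<le> real l * (b + real k / real l * a)"
    by (intro mult_left_mono) auto
  also have "\<dots> = a * real k + b * real l" using assms by (simp add: field_simps)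
  finally show ?thesis using False by (simp add: exponent_def)
qed

definition bounded_below :: "real \<Rightarrow> real \<Rightarrow> nat \<Rightarrow> nat \<Rightarrow> bool" where
  "bounded_below e C k l \<longleftrightarrow> (\<forall>k' l'. 1 \<le> k' \<longrightarrow> 1 \<le> l' \<longrightarrow> k' + l' < k + l \<longrightarrow>
     real (ramsey_number k' l') \<le> exp (exponent k' l' + e * real (max k' l') + C))"

text \<open>For j = k the pair is not smaller, so the hypothesis does not apply to it directly; one
  step of the recursion for Ramsey numbers leads to smaller pairs at the price of ln 2.\<close>

lemma bounded_below_region:
  assumes bb: "bounded_below e C k l" and e: "0 \<le> e" and C: "0 \<le> C" and ab: "region a b" "0 \<le> a" "0 \<le> b"
    and kl: "2 \<le> l" "l \<le> k" and j: "j \<le> k"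
  shows "real (ramsey_number j l) \<le> exp (a * real j) * exp (b * real l + e * real k + C + ln 2)"
proof -
  have *: "real (ramsey_number k' l') \<le> exp (a * real k' + b * real l' + e * real k + C)"
    if "1 \<le> k'" "1 \<le> l'" "k' + l' < k + l" "k' \<le> k" "l' \<le> k" for k' l'
  proof -
    have "real (ramsey_number k' l') \<le> exp (exponent k' l' + e * real (max k' l') + C)"
      using bb that unfolding bounded_below_def by blast
    also have "\<dots> \<le> exp (a * real k' + b * real l' + e * real k + C)"
      using exponent_le[OF ab(1) that(1,2)] e that by (auto intro!: add_mono mult_left_mono)
    finally show ?thesis .
  qed
  consider "j = 0" | "1 \<le> j" "j < k" | "j = k" using j by linarith
  then show ?thesis
  proof cases
    case 1
    then show ?thesis using e C ab by (simp flip: exp_add)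
  next
    case 2
    have "real (ramsey_number j l) \<le> exp (a * real j + b * real l + e * real k + C)"
      using * 2 kl by auto
    also have "\<dots> \<le> exp (a * real j + (b * real l + e * real k + C + ln 2))"
      by simp
    finally show ?thesis by (simp add: exp_add)
  next
    case 3
    have "real (ramsey_number k l) \<le> real (ramsey_number (k - 1) l) + real (ramsey_number k (l - 1))"
      using ramsey_number_rec[of k l] kl by (simp flip: of_nat_add)
    also have "\<dots> \<le> exp (a * real (k - 1) + b * real l + e * real k + C)
        + exp (a * real k + b * real (l - 1) + e * real k + C)"
      using kl by (intro add_mono *) auto
    also have "\<dots> \<le> exp (a * real k + b * real l + e * real k + C) + exp (a * real k + b * real l + e * real k + C)"
      using ab kl by (intro add_mono) (auto intro!: mult_left_mono)
    also have "\<dots> = exp (a * real k) * exp (b * real l + e * real k + C + ln 2)"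
      by (simp add: exp_add)
    finally show ?thesis using 3 by simp
  qed
qed

lemma red_degree_lower:
  fixes E :: "nat \<Rightarrow> nat \<Rightarrow> bool"
  assumes E: "symp E" "irreflp E" and V: "finite V" "v \<in> V"
    and no: "\<not> has_clique E V k" "\<not> has_clique (blue E) V l" and l: "1 \<le> l"
  shows "real (card V) \<le> real (card (nbh E v V)) + real (ramsey_number k (l - 1))"
proof -
  define B where "B = nbh (blue E) v V"
  have "\<not> has_clique E B k" using no(1) has_clique_mono nbh_subset unfolding B_def by metis
  moreover have "\<not> has_clique (blue E) B (l - 1)"
  proof
    assume "has_clique (blue E) B (l - 1)"
    then have "has_clique (blue E) (insert v B) (Suc (l - 1))"
    proof (rule has_clique_insert)
      show "\<not> E u v \<and> \<not> E v u" if "u \<in> B" for u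
        using that E(1) unfolding B_def nbh_def by (auto dest: sympD)
    qed (simp add: B_def)
    moreover have "insert v B \<subseteq> V" using V by (auto simp: B_def nbh_def)
    ultimately show False using no(2) l has_clique_mono by (metis Suc_diff_1 less_le_trans zero_less_one)
  qed
  ultimately have "card B < ramsey_number k (l - 1)"
    using ramsey_number_cliques[of B k "l - 1" E] E V by (force simp: B_def)
  moreover have "V = insert v (nbh E v V \<union> B)" using V by (auto simp: B_def nbh_def)
  then have "card V \<le> Suc (card (nbh E v V \<union> B))"
    by (metis card_insert_le_m1 card_insert_if V(1) finite_Un finite_insert le_Suc_eq eq_refl)
  moreover have "card (nbh E v V \<union> B) \<le> card (nbh E v V) + card B" by (rule card_Un_le)
  ultimately show ?thesis by linarith
qed

lemma isCont_nearby:
  fixes f :: "real \<Rightarrow> real"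
  assumes "isCont f x" "0 < e"
  obtains d where "0 < d" "\<And>y. \<bar>y - x\<bar> < d \<Longrightarrow> \<bar>f y - f x\<bar> < e"
  using assms unfolding continuous_at_eps_delta dist_real_def by blast

text \<open>Raising a by e leaves room to lower the density. The conditions depending on the ratio
  then hold near x for the same parameters by continuity, and the gap between \<open>p\<close> and
  \<open>p'\<close> provides a positive initial q.\<close>

lemma admissible_neighbourhood:
  assumes x: "0 < x" "x \<le> 1" and e: "0 < e"
  obtains d p p' M a b where "0 < d" "d \<le> x / 2" "0 < p" "p < p'" "p' < 1" "0 < M" "M < 1" "0 \<le> a" "0 \<le> b"
    "- ln p < (1 - M) * (a + e + ln (1 - M))" "region a b"
    "\<And>y. \<bar>y - x\<bar> < d \<Longrightarrow> - dF y \<le> ln (1 - p')"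
    "\<And>y. \<bar>y - x\<bar> < d \<Longrightarrow> a + y * (b - ln M) \<le> 2 * F y + e"
proof -
  obtain p0 M a b where A: "0 < p0" "p0 < 1" "0 < M" "M < 1" "0 \<le> a" "0 \<le> b"
    "- dF x \<le> ln (1 - p0)" "- ln p0 \<le> (1 - M) * (a + ln (1 - M))" "region a b"
    "a + x * (b - ln M) \<le> 2 * F x"
    using admissible_unit_interval[OF x] unfolding admissible_def by blast
  \<comment> \<open>A density satisfies the strict inequality with a + e exactly if it exceeds
    \<open>t\<close>; \<open>p\<close> and \<open>p'\<close> trisect the interval from
    \<open>t\<close> to \<open>p0\<close>.\<close>
  define t where "t = exp (- ((1 - M) * (a + e + ln (1 - M))))"
  have "(1 - M) * (a + ln (1 - M)) < (1 - M) * (a + e + ln (1 - M))"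
    using A e by (intro mult_strict_left_mono) auto
  then have "- ln p0 < (1 - M) * (a + e + ln (1 - M))" using A(8) by linarith
  then have "t < exp (ln p0)" unfolding t_def by simp
  then have tp: "0 < t" "t < p0" using A by (auto simp: t_def)
  define p p' where "p = (2 * t + p0) / 3" and "p' = (t + 2 * p0) / 3"
  have pp: "0 < p" "t < p" "p < p'" "p' < p0" using tp by (auto simp: p_def p'_def field_simps)
  have "ln t < ln p" using tp pp by simp
  then have lnp: "- ln p < (1 - M) * (a + e + ln (1 - M))" by (simp add: t_def)
  have "ln (1 - p0) < ln (1 - p')" using pp A by simp
  then have pos: "0 < ln (1 - p') + dF x" using A(7) by linarith
  define f where "f y = 2 * F y - (a + y * (b - ln M))" for y
  have "isCont dF x" using DERIV_dF[OF x(1)] by (rule DERIV_isCont)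
  then obtain d1 where d1: "0 < d1" "\<And>y. \<bar>y - x\<bar> < d1 \<Longrightarrow> \<bar>dF y - dF x\<bar> < ln (1 - p') + dF x"
    using isCont_nearby[OF _ pos] by metis
  have "isCont F x" using DERIV_F[OF x(1)] by (rule DERIV_isCont)
  then have "isCont f x" unfolding f_def by (intro continuous_intros)
  then obtain d2 where d2: "0 < d2" "\<And>y. \<bar>y - x\<bar> < d2 \<Longrightarrow> \<bar>f y - f x\<bar> < e"
    using isCont_nearby[OF _ e] by metis
  show thesis
  proof (rule that[of "min (x / 2) (min d1 d2)" p p' M a b])
    fix y assume "\<bar>y - x\<bar> < min (x / 2) (min d1 d2)"
    then have y: "\<bar>y - x\<bar> < d1" "\<bar>y - x\<bar> < d2" by auto
    show "- dF y \<le> ln (1 - p')" using d1(2)[OF y(1)] by linarith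
    have "0 \<le> f x" using A(10) by (simp add: f_def)
    then show "a + y * (b - ln M) \<le> 2 * F y + e"
      using d2(2)[OF y(2)] unfolding f_def by linarith
  qed (use A pp lnp d1 d2 x in auto)
qed

text \<open>For fixed s this is polynomial in k, so the threshold w = R(k, s) costs only O(ln k) in
  the exponent.\<close>

lemma ramsey_number_le_power: "real (ramsey_number k s) \<le> real (k + s) ^ s"
proof -
  have "1 * real ((k + s) choose s) \<le> fact s * real ((k + s) choose s)"
    by (intro mult_right_mono) auto
  also have "\<dots> \<le> real (k + s) ^ s" by (rule fact_choose_upper)
  finally show ?thesis using ramsey_number_le_choose[of k s] by linarith
qed

text \<open>The induction step for ratios near x. That K does not depend on C is essential: C is
  later chosen in terms of the pairs with small k.\<close>

lemma ramsey_step: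
  assumes x: "0 < x" "x \<le> 1" and e: "0 < e"
  obtains d K where "0 < d"
    "\<And>k l C. \<lbrakk>K \<le> k; 1 \<le> l; l \<le> k; \<bar>real l / real k - x\<bar> < d; 0 \<le> C; bounded_below e C k l\<rbrakk>
       \<Longrightarrow> real (ramsey_number k l) \<le> exp (real k * F (real l / real k) + e * real k + C)"
proof -
  define \<epsilon> where "\<epsilon> = e / 8"
  have \<epsilon>: "0 < \<epsilon>" using e by (simp add: \<epsilon>_def)
  obtain d p p' M a b where d: "0 < d" "d \<le> x / 2" and p: "0 < p" "p < p'" "p' < 1" and M: "0 < M" "M < 1"
    and ab: "0 \<le> a" "0 \<le> b" "- ln p < (1 - M) * (a + \<epsilon> + ln (1 - M))" "region a b"
    and dF: "\<And>y. \<bar>y - x\<bar> < d \<Longrightarrow> - dF y \<le> ln (1 - p')"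
    and F: "\<And>y. \<bar>y - x\<bar> < d \<Longrightarrow> a + y * (b - ln M) \<le> 2 * F y + \<epsilon>"
    using admissible_neighbourhood[OF x \<epsilon>] by metis
  have p1: "p < 1" using p by simp
  obtain c :: nat and \<alpha> \<gamma> \<eta> where c: "2 \<le> c" and ag: "0 < \<alpha>" "\<alpha> \<le> \<gamma>" "0 < \<eta>"
    "(1 - M) * \<alpha> + M * \<gamma> < 1 - \<eta>" "exp (- (a + \<epsilon>)) / p \<le> \<alpha> ^ c * (1 - M)" "1 / p \<le> \<gamma> ^ c"
    using step_parameters[OF p(1) p1 M ab(3)] by metis
  define m where "m = - ln M + \<epsilon>"
  define A where "A = (1 - 1 / real c) ^ c / 2"
  have A: "0 < A" using c by (simp add: A_def)
  \<comment> \<open>A blue step is charged M exp (- \<epsilon>) instead of M. Over b0 simultaneous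
    steps this saves exp (\<epsilon> b0), which for large b0 pays for the factor 1/2 of
    \<open>common_neighbourhood\<close> and for (1 - 1/c)^c.\<close>
  obtain n :: nat where n: "(- ln A) / \<epsilon> < real n" using reals_Archimedean2 by blast
  define b0 where "b0 = Suc n"
  have b0: "1 \<le> b0" "1 \<le> (1 - 1 / real c) ^ c * exp (m * real b0) * (M ^ b0 / 2)"
  proof -
    have "- ln A < real n * \<epsilon>" using n[unfolded pos_divide_less_eq[OF \<epsilon>]] .
    also have "\<dots> < \<epsilon> * real b0" using \<epsilon> by (simp add: b0_def)
    finally have "- ln A < \<epsilon> * real b0" .
    then have "exp (- ln A) \<le> exp (\<epsilon> * real b0)" by simp
    then have "1 \<le> A * exp (\<epsilon> * real b0)" using A by (simp add: exp_minus field_simps)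
    also have "exp (\<epsilon> * real b0) = exp (m * real b0) * M ^ b0"
    proof -
      have "M ^ b0 = exp (real b0 * ln M)" using M by (simp add: exp_of_nat_mult)
      then show ?thesis by (simp add: m_def algebra_simps flip: exp_add)
    qed
    finally show "1 \<le> (1 - 1 / real c) ^ c * exp (m * real b0) * (M ^ b0 / 2)"
      by (simp add: A_def mult_ac)
  qed (simp add: b0_def)
  obtain s :: nat where s: "2 * real b0 ^ 2 / M < real s" using reals_Archimedean2 by blast
  define B where "B = (2 / p + 1) / \<eta> + 2"
  have B: "0 < B" using p ag by (simp add: B_def add_pos_pos)
  \<comment> \<open>The part independent of k in the bound for ln H + ln 8 - c ln q0, with the
    initial q at least q0 = (p' - p)/2.\<close>
  define D where "D = ln B + real s * ln (1 + real s) + ln 8 - real c * ln ((p' - p) / 2)"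
  obtain K1 where K1: "\<And>k. K1 \<le> k \<Longrightarrow> D + real s * ln (real k) \<le> \<epsilon> * real k"
    using eventually_log_linear[OF \<epsilon>] by metis
  \<comment> \<open>4/x ensures l \<ge> 2, as l/k > x/2; the last bound makes N so large that
    rounding costs at most half of p' - p.\<close>
  obtain K2 :: nat where K2: "max (4 / x) (max 1 (8 / (e * (p' - p)))) < real K2"
    using reals_Archimedean2 by blast
  show thesis
  proof (rule that[OF d(1), of "max K1 K2"])
    fix k l :: nat and C :: real
    assume k: "max K1 K2 \<le> k" and l: "1 \<le> l" "l \<le> k" and y: "\<bar>real l / real k - x\<bar> < d"
      and C: "0 \<le> C" and bb: "bounded_below e C k l"
    define y where "y = real l / real k"
    have kK: "4 / x < real k" "1 < real k" "8 / (e * (p' - p)) < real k"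
      using K2 k by (auto simp: max_def split: if_splits)
    have k0: "0 < real k" using kK by simp
    have y01: "0 < y" "y \<le> 1" using l k0 by (auto simp: y_def divide_le_eq)
    have l2: "2 \<le> l"
    proof -
      have "x / 2 < y" using y d unfolding y_def by linarith
      then have "x / 2 * real k < real l" using k0 by (simp add: y_def field_simps)
      moreover have "2 < x / 2 * real k" using kK x by (simp add: field_simps)
      ultimately show ?thesis by linarith
    qed
    define T where "T = real k * F y + e * real k + C"
    have T: "e * real k \<le> T" using F_nonneg[OF y01] C k0 by (simp add: T_def)
    define N where "N = nat \<lfloor>exp T\<rfloor>"
    have T0: "0 \<le> T" using T e k0 by (smt (verit) mult_pos_pos)
    have N: "real N \<le> exp T" "exp T < real N + 1" "0 < N"
      using T0 by (auto simp: N_def)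
    have "ramsey_number k l \<le> N"
    proof (rule ramsey_number_le[OF N(3)], rule ccontr)
      fix E :: "nat \<Rightarrow> nat \<Rightarrow> bool"
      assume E: "symp E" "irreflp E" and neg: "\<not> (has_clique E {..<N} k \<or> has_clique (blue E) {..<N} l)"
      define V where "V = {..<N}"
      have V: "finite V" "card V = N" by (auto simp: V_def)
      have no: "\<not> has_clique E V k" "\<not> has_clique (blue E) V l" using neg by (auto simp: V_def)
      \<comment> \<open>By concavity, passing from l to l - 1 lowers k F(l/k) by at least dF y,
        while e k + C stays the same; so R(k, l - 1) is at most the fraction exp (- dF y) \<le> 1 -
        p' of exp T.\<close>
      have bl: "real (ramsey_number k (l - 1)) \<le> (1 - p') * exp T"
      proof -
        have l1: "real (l - 1) / real k = y - 1 / real k"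
          using l by (simp add: y_def of_nat_diff diff_divide_distrib)
        have "real (ramsey_number k (l - 1)) \<le> exp (exponent k (l - 1) + e * real (max k (l - 1)) + C)"
          using l2 l by (intro bb[unfolded bounded_below_def, rule_format]) auto
        also have "exponent k (l - 1) + e * real (max k (l - 1)) + C = real k * F (y - 1 / real k) + e * real k + C"
          using l l1 by (simp add: exponent_def max_def)
        also have "\<dots> \<le> T - dF y"
        proof -
          have "0 < y - 1 / real k" "y - 1 / real k \<le> 1"
            unfolding l1[symmetric] using l2 l k0 by (auto simp: divide_le_eq)
          then have "F (y - 1 / real k) \<le> F y + dF y * ((y - 1 / real k) - y)"
            using F_le_tangent[OF y01] by blast
          then have "real k * F (y - 1 / real k) \<le> real k * (F y + dF y * (- (1 / real k)))"
            using k0 by (intro mult_left_mono) auto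
          also have "\<dots> = real k * F y - dF y" using k0 by (simp add: field_simps)
          finally show ?thesis by (simp add: T_def)
        qed
        also have "exp (T - dF y) = exp T * exp (- dF y)" by (simp flip: exp_add)
        also have "\<dots> \<le> exp T * exp (ln (1 - p'))"
          using dF[of y] y by (intro mult_left_mono) (auto simp: y_def)
        also have "\<dots> = (1 - p') * exp T" using p by simp
        finally show ?thesis by simp
      qed
      have deg: "p' * real N - 1 \<le> real (card (nbh E v V))" if "v \<in> V" for v
      proof -
        have "real N \<le> real (card (nbh E v V)) + real (ramsey_number k (l - 1))"
          using red_degree_lower[OF E V(1) that no l(1)] V by simp
        also have "\<dots> \<le> real (card (nbh E v V)) + (1 - p') * (real N + 1)"
          using bl N(2) p by (smt (verit) mult_left_mono)
        finally show ?thesis using p by (simp add: algebra_simps)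
      qed
      have Nbig: "2 \<le> (p' - p) * real N"
      proof -
        have "8 < e * real k * (p' - p)" using kK(3) e p by (simp add: field_simps)
        also have "\<dots> \<le> exp T * (p' - p)"
        proof (rule mult_right_mono)
          show "e * real k \<le> exp T" using T exp_ge_add_one_self[of T] by linarith
        qed (use p in simp)
        also have "\<dots> \<le> (2 * real N) * (p' - p)"
        proof (rule mult_right_mono)
          have "1 \<le> real N" using N(3) by simp
          then show "exp T \<le> 2 * real N" using N(2) by linarith
        qed (use p in simp)
        also have "\<dots> = 2 * ((p' - p) * real N)" by simp
        finally show ?thesis by linarith
      qed
      have exc: "(p' - p) / 2 * (real N * real N) \<le> excess E p V V"
      proof -
        have "(p' - p) / 2 * (real N * real N) = (\<Sum>v\<in>V. (p' - p) / 2 * real N)"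
          by (simp add: V)
        also have "\<dots> \<le> excess E p V V"
          unfolding excess_def V(2)
        proof (rule sum_mono)
          fix v assume "v \<in> V"
          then show "(p' - p) / 2 * real N \<le> real (card (nbh E v V)) - p * real N"
            using deg[of v] Nbig by (simp add: field_simps)
        qed
        finally show ?thesis .
      qed
      have NN: "0 < real N * real N" using N by simp
      have rel: "(p' - p) / 2 \<le> rel_excess E p V V"
        unfolding rel_excess_def V(2) using exc NN by (simp add: pos_le_divide_eq)
      have exc0: "0 < excess E p V V" using exc NN p by (smt (verit) divide_pos_pos mult_pos_pos)
      define w where "w = ramsey_number k s"
      define Q where "Q = exp (b * real l + e * real k + C + ln 2)"
      define H where "H = (2 * real w / p + 1) / \<eta> + 2 * real w"
      note \<eta> = ag(3) and pp = p and card_V = V(2)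
      interpret book E V p M "a + \<epsilon>" m \<eta> \<alpha> \<gamma> H Q c b0 s w k l
      proof
        have "exp (- m) \<le> exp (ln M)" unfolding exp_le_cancel_iff m_def using \<epsilon> by simp
        then show "exp (- m) \<le> M" using M by simp
        show "2 * real b0 ^ 2 \<le> M * real s" using s M by (simp add: field_simps)
        show "has_clique E W k \<or> has_clique (blue E) W s" if "W \<subseteq> V" "w \<le> card W" for W
          using that V E by (intro ramsey_number_cliques) (auto simp: w_def finite_subset)
        show "has_clique E Z j \<or> has_clique (blue E) Z l"
          if "Z \<subseteq> V" "j \<le> k" "exp ((a + \<epsilon>) * real j) * Q \<le> real (card Z)" for Z j
        proof (rule ramsey_number_cliques)
          show "finite Z" using that V finite_subset by blast
          have "real (ramsey_number j l) \<le> exp (a * real j) * Q"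
            unfolding Q_def using bounded_below_region[OF bb _ C ab(4,1,2) l2 l(2) that(2)] e by simp
          also have "\<dots> \<le> exp ((a + \<epsilon>) * real j) * Q"
            using \<epsilon> by (intro mult_right_mono) (auto simp: Q_def mult_right_mono)
          finally show "ramsey_number j l \<le> card Z" using that(3) by simp
        qed (use E in auto)
        have "0 < (2 * real w / p + 1) / \<eta>" using p ag by (intro divide_pos_pos add_nonneg_pos) auto
        then show "0 < H" unfolding H_def by (intro add_pos_nonneg) auto
        show "2 * real w \<le> H" using p ag by (simp add: H_def)
        have "\<eta> * ((2 * real w / p + 1) / \<eta>) = 2 * real w / p + 1" using ag by simp
        then show "2 * real w / p + 1 \<le> \<eta> * H" unfolding H_def distrib_left using ag by simp
        show "0 < Q" by (simp add: Q_def)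
      qed (use E V p p1 M c ag b0 in auto)
      have H: "H \<le> B * (((1 + real s) * real k) ^ s)"
      proof -
        have w1: "1 \<le> real w" using ramsey_number_pos[of k s] by (simp add: w_def)
        have "H \<le> (2 * real w / p + real w) / \<eta> + 2 * real w"
          unfolding H_def
          by (intro add_right_mono divide_right_mono add_left_mono) (use w1 \<eta> in auto)
        also have "\<dots> = B * real w" using p \<eta> by (simp add: B_def field_simps)
        also have "\<dots> \<le> B * real (k + s) ^ s"
          using ramsey_number_le_power B by (intro mult_left_mono) (auto simp: w_def)
        also have "\<dots> \<le> B * (((1 + real s) * real k) ^ s)"
        proof -
          have "real s * 1 \<le> real s * real k" using kK by (intro mult_left_mono) auto
          then have "real (k + s) \<le> (1 + real s) * real k" by (simp add: algebra_simps)
          then show ?thesis using B by (intro mult_left_mono power_mono) auto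
        qed
        finally show ?thesis .
      qed
      have lnH: "ln H \<le> ln B + real s * ln (1 + real s) + real s * ln (real k)"
      proof -
        have "ln H \<le> ln (B * (((1 + real s) * real k) ^ s))"
          using H book_axioms unfolding book_def by simp
        also have "\<dots> = ln B + real s * (ln (1 + real s) + ln (real k))"
          using B k0 by (simp add: ln_mult_pos ln_realpow)
        finally show ?thesis by (simp add: algebra_simps)
      qed
      define q0 where "q0 = (p' - p) / 2"
      have q0: "0 < q0" using pp by (simp add: q0_def)
      have "goal V V k l"
      proof (rule book_induct[OF order_refl order_refl order_refl exc0])
        have "exp ((a + \<epsilon>) * real k + m * real l) * (Q * H)
            = exp ((a + \<epsilon>) * real k + m * real l + (b * real l + e * real k + C + ln 2) + ln H)"
          using book_axioms by (simp add: Q_def exp_add book_def)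
        \<comment> \<open>Of the surplus e k = 8 \<epsilon> k at most four shares are spent: on the
          slack at y, on a + \<epsilon>, on m, and on ln H + ln 8 - c ln q0. The term ln 4 comes
          from N \<ge> exp T / 2.\<close>
        also have "\<dots> \<le> exp (2 * T - ln 4 + real c * ln q0)"
        proof -
          have 0: "real k * (a + y * (b - ln M)) \<le> real k * (2 * F y + \<epsilon>)"
            using F[of y] y k0 by (intro mult_left_mono) (auto simp: y_def)
          have 1: "a * real k + b * real l - ln M * real l \<le> 2 * (real k * F y) + \<epsilon> * real k"
          proof -
            have ky: "real k * y = real l" using k0 by (simp add: y_def)
            have "real k * (a + y * (b - ln M)) = a * real k + b * (real k * y) - ln M * (real k * y)"
              by (simp add: algebra_simps)
            moreover have "real k * (2 * F y + \<epsilon>) = 2 * (real k * F y) + \<epsilon> * real k"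
              by (simp add: algebra_simps)
            ultimately show ?thesis using 0 unfolding ky by linarith
          qed
          have 2: "\<epsilon> * real l \<le> \<epsilon> * real k" using \<epsilon> l by simp
          have 3: "ln (8 :: real) = ln 2 + ln 4" using ln_mult_pos[of "2 :: real" 4] by simp
          have "D + real s * ln (real k) \<le> \<epsilon> * real k" using K1[of k] k by simp
          then have 4: "ln H + ln 8 - real c * ln q0 \<le> \<epsilon> * real k"
            using lnH by (simp add: D_def q0_def)
          have 5: "e * real k = 8 * (\<epsilon> * real k)" by (simp add: \<epsilon>_def)
          have 6: "0 \<le> \<epsilon> * real k" using \<epsilon> by simp
          have "(a + \<epsilon>) * real k + m * real l + (b * real l + e * real k + C + ln 2) + ln H
             = (a * real k + b * real l - ln M * real l) + \<epsilon> * real k + \<epsilon> * real l + e * real k + C + ln 2 + ln H"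
            by (simp add: m_def algebra_simps)
          moreover have "2 * T = 2 * (real k * F y) + 2 * (e * real k) + 2 * C"
            by (simp add: T_def)
          ultimately show ?thesis using 1 2 3 4 5 6 C unfolding exp_le_cancel_iff by linarith
        qed
        also have "\<dots> = (exp T / 2) * (exp T / 2) * q0 ^ c"
        proof -
          have "exp (2 * T) = exp T * exp T" by (simp flip: exp_add)
          moreover have "exp (real c * ln q0) = q0 ^ c" using q0 by (simp add: exp_of_nat_mult)
          ultimately show ?thesis by (simp add: exp_add exp_diff)
        qed
        also have "\<dots> \<le> real N * real N * q0 ^ c"
        proof -
          have "1 \<le> real N" using N(3) by simp
          then have "exp T / 2 \<le> real N" using N(2) by linarith
          then show ?thesis using q0 by (intro mult_right_mono mult_mono) auto
        qed
        also have "\<dots> \<le> real N * real N * rel_excess E p V V ^ c"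
          using rel q0 by (intro mult_left_mono power_mono) (auto simp: q0_def)
        finally show "exp ((a + \<epsilon>) * real k + m * real l) * (Q * H) \<le> potential V V"
          by (simp add: potential_def card_V)
      qed
      then show False using no by (auto simp: goal_def)
    qed
    then have "real (ramsey_number k l) \<le> real N" by simp
    then show "real (ramsey_number k l) \<le> exp (real k * F (real l / real k) + e * real k + C)"
      using N(1) by (simp add: T_def y_def)
  qed
qed

text \<open>\<open>ramsey_step\<close> is local in the ratio, so compactness of [\<delta>, 1] yields
  one threshold \<open>K0\<close>. Ratios below \<delta> follow from the binomial bound, as F0
  exceeds F by at most y/4 there, and the finitely many pairs with k < K0 are absorbed by C.\<close>

lemma ramsey_exponent_bound:
  assumes e: "0 < e"
  obtains C where "\<And>k l. 1 \<le> l \<Longrightarrow> l \<le> k \<Longrightarrow>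
    real (ramsey_number k l) \<le> exp (real k * F (real l / real k) + e * real k + C)"
proof -
  define \<delta> where "\<delta> = min 1 e"
  have \<delta>: "0 < \<delta>" "\<delta> \<le> 1" "\<delta> \<le> e" using e by (auto simp: \<delta>_def)
  define P where "P x d K \<longleftrightarrow> 0 < d \<and> (\<forall>k l C. K \<le> k \<longrightarrow> 1 \<le> l \<longrightarrow> l \<le> k \<longrightarrow> \<bar>real l / real k - x\<bar> < d \<longrightarrow>
     0 \<le> C \<longrightarrow> bounded_below e C k l \<longrightarrow>
     real (ramsey_number k l) \<le> exp (real k * F (real l / real k) + e * real k + C))" for x d :: real and K :: nat
  have "\<exists>d K. P x d K" if "x \<in> {\<delta>..1}" for x
  proof -
    have x: "0 < x" "x \<le> 1" using that \<delta> by auto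
    show ?thesis
    proof (rule ramsey_step[OF x e])
      fix d K
      assume "0 < d" "\<And>k l C. \<lbrakk>K \<le> k; 1 \<le> l; l \<le> k; \<bar>real l / real k - x\<bar> < d; 0 \<le> C; bounded_below e C k l\<rbrakk>
         \<Longrightarrow> real (ramsey_number k l) \<le> exp (real k * F (real l / real k) + e * real k + C)"
      then have "P x d K" unfolding P_def by blast
      then show "\<exists>d K. P x d K" by blast
    qed
  qed
  then obtain d K where dK: "\<And>x. x \<in> {\<delta>..1} \<Longrightarrow> P x (d x) (K x)" by metis
  have "{\<delta>..1} \<subseteq> (\<Union>x\<in>{\<delta>..1}. ball x (d x))"
  proof
    fix x assume x: "x \<in> {\<delta>..1}"
    then have "0 < d x" using dK unfolding P_def by blast
    then show "x \<in> (\<Union>x\<in>{\<delta>..1}. ball x (d x))" using x by (intro UN_I[of x]) auto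
  qed
  then obtain D where D: "D \<subseteq> {\<delta>..1}" "finite D" "{\<delta>..1} \<subseteq> (\<Union>x\<in>D. ball x (d x))"
    using compactE_image[of "{\<delta>..1}" "{\<delta>..1}" "\<lambda>x. ball x (d x)"] by auto
  define K0 where "K0 = (\<Sum>x\<in>D. K x)"
  define S where "S = (\<Sum>k<K0. \<Sum>l\<le>k. real (ramsey_number k l))"
  define C where "C = ln (1 + S)"
  have S0: "0 \<le> S" unfolding S_def by (intro sum_nonneg) auto
  then have C0: "0 \<le> C" by (simp add: C_def)
  have main: "real (ramsey_number k l) \<le> exp (real k * F (real l / real k) + e * real k + C)"
    if kl: "1 \<le> l" "l \<le> k" and bb: "bounded_below e C k l" for k l
  proof -
    define y where "y = real l / real k"
    have k0: "0 < real k" using kl by simp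
    have y: "0 < y" "y \<le> 1" using kl by (auto simp: y_def divide_le_eq)
    have F0: "0 \<le> real k * F y" using F_nonneg[OF y] k0 by simp
    consider "k < K0" | "y < \<delta>" | "K0 \<le> k" "\<delta> \<le> y" by linarith
    then show ?thesis
    proof cases
      case 1
      have "real (ramsey_number k l) \<le> (\<Sum>l\<le>k. real (ramsey_number k l))"
        using kl by (intro member_le_sum) auto
      also have "\<dots> \<le> S"
        unfolding S_def using 1
        by (intro member_le_sum[where f = "\<lambda>k. \<Sum>l\<le>k. real (ramsey_number k l)"]) (auto intro: sum_nonneg)
      also have "\<dots> \<le> exp C" using S0 by (simp add: C_def)
      also have "\<dots> \<le> exp (real k * F y + e * real k + C)" using F0 e by simp
      finally show ?thesis by (simp add: y_def)
    next
      case 2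
      have "real (ramsey_number k l) \<le> real ((k + l) choose l)"
        using ramsey_number_le_choose[of k l] by simp
      also have "\<dots> \<le> exp (real k * F0 y)" using choose_bounds(1)[of k l] kl by (simp add: y_def)
      also have "real k * F0 y \<le> real k * F y + e * real k"
      proof -
        have "F0 y \<le> F y + y / 4" using G_lower[of y] y by (simp add: F_eq)
        also have "\<dots> \<le> F y + e" using 2 \<delta> y by simp
        finally have "real k * F0 y \<le> real k * (F y + e)" using k0 by (intro mult_left_mono) auto
        then show ?thesis by (simp add: algebra_simps)
      qed
      finally show ?thesis using C0 by (simp add: y_def) (smt (verit) exp_le_cancel_iff)
    next
      case 3
      have "y \<in> {\<delta>..1}" using 3 y by simp
      then obtain x where x: "x \<in> D" "y \<in> ball x (d x)" using D(3) by blast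
      have yx: "\<bar>y - x\<bar> < d x" using x(2) by (simp add: dist_real_def abs_minus_commute)
      have "K x \<le> K0" unfolding K0_def using x D by (intro member_le_sum) auto
      moreover have "P x (d x) (K x)" using dK x(1) D(1) by blast
      ultimately show ?thesis
        using 3(1) kl bb C0 yx[unfolded y_def] unfolding P_def by (meson order_trans)
    qed
  qed
  have all: "real (ramsey_number k l) \<le> exp (exponent k l + e * real (max k l) + C)" if "1 \<le> k" "1 \<le> l" for k l
    using that
  proof (induction "k + l" arbitrary: k l rule: less_induct)
    case less
    have bb: "bounded_below e C k l" unfolding bounded_below_def using less.hyps by blast
    show ?case
    proof (cases "l \<le> k")
      case True
      then show ?thesis using main[OF less.prems(2) True bb] by (simp add: exponent_def max_def)
    next
      case False
      have "bounded_below e C l k" using bb by (simp add: bounded_below_def add.commute)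
      then show ?thesis
        using main[of k l] False less.prems
        by (simp add: exponent_def max_def ramsey_number_commute[of k l])
    qed
  qed
  show thesis
  proof (rule that[of C])
    fix k l :: nat assume kl: "1 \<le> l" "l \<le> k"
    then show "real (ramsey_number k l) \<le> exp (real k * F (real l / real k) + e * real k + C)"
      using all[of k l] by (simp add: exponent_def max_def)
  qed
qed

theorem theorem1p1:
  shows "\<exists>h :: nat \<Rightarrow> real.
           (\<lambda>k. h k / real k) \<longlonglongrightarrow> 0 \<and>
           (\<forall>k l :: nat. 1 \<le> l \<and> l \<le> k \<longrightarrow>
              real (ramsey_number k l)
                \<le> exp (G (real l / real k) * real k + h k) * real ((k + l) choose l))"
proof -
  define g where "g k l = ln (real (ramsey_number k l)) - G (real l / real k) * real k - ln (real ((k + l) choose l))" for k l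
  \<comment> \<open>The least nonnegative error that serves all l \<le> k at once; inserting 0 also
    keeps the set nonempty for k = 0.\<close>
  define h where "h k = Max (insert 0 (g k ` {1..k}))" for k
  have h: "0 \<le> h k" "1 \<le> l \<Longrightarrow> l \<le> k \<Longrightarrow> g k l \<le> h k" for k l
    unfolding h_def by (rule Max_ge; simp)+
  have "real (ramsey_number k l) \<le> exp (G (real l / real k) * real k + h k) * real ((k + l) choose l)"
    if "1 \<le> l" "l \<le> k" for k l
  proof -
    have R: "0 < real (ramsey_number k l)" using ramsey_number_pos by simp
    have "real (ramsey_number k l) = exp (ln (real (ramsey_number k l)))" using R by simp
    also have "\<dots> \<le> exp (G (real l / real k) * real k + h k + ln (real ((k + l) choose l)))"
      using h(2)[OF that] by (simp add: g_def)
    also have "\<dots> = exp (G (real l / real k) * real k + h k) * real ((k + l) choose l)"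
      by (simp add: exp_add)
    finally show ?thesis .
  qed
  moreover have "(\<lambda>k. h k / real k) \<longlonglongrightarrow> 0"
  proof (rule LIMSEQ_I)
    fix r :: real assume r: "0 < r"
    \<comment> \<open>One share e k is the error of \<open>ramsey_exponent_bound\<close>, the other
      absorbs C and the polynomial factor k + l + 1 \<le> 3 k; together they stay below r k.\<close>
    define e where "e = r / 4"
    have e: "0 < e" using r by (simp add: e_def)
    obtain C where C: "\<And>k l. 1 \<le> l \<Longrightarrow> l \<le> k \<Longrightarrow>
        real (ramsey_number k l) \<le> exp (real k * F (real l / real k) + e * real k + C)"
      using ramsey_exponent_bound[OF e] by metis
    obtain K where K: "\<And>k. K \<le> k \<Longrightarrow> (C + ln 3) + 1 * ln (real k) \<le> e * real k"
      using eventually_log_linear[OF e] by metis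
    have "norm (h k / real k - 0) < r" if k: "max 1 K \<le> k" for k
    proof -
      have k1: "1 \<le> k" "0 < real k" using k by auto
      have "g k l \<le> 2 * e * real k" if l: "1 \<le> l" "l \<le> k" for l
      proof -
        have "0 < real (ramsey_number k l)" using ramsey_number_pos by simp
        then have "ln (real (ramsey_number k l)) \<le> real k * F (real l / real k) + e * real k + C"
          using C[OF l] by (metis exp_ln exp_le_cancel_iff)
        moreover have "real k * F0 (real l / real k) \<le> ln (real (k + l + 1)) + ln (real ((k + l) choose l))"
        proof -
          have ch: "0 < real ((k + l) choose l)" by simp
          have "ln (exp (real k * F0 (real l / real k))) \<le> ln (real (k + l + 1) * real ((k + l) choose l))"
            using choose_bounds(2)[of k l] k1 l ch by (subst ln_le_cancel_iff) auto
          also have "\<dots> = ln (real (k + l + 1)) + ln (real ((k + l) choose l))"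
            using ch by (intro ln_mult_pos) auto
          finally show ?thesis by simp
        qed
        moreover have "ln (real (k + l + 1)) \<le> ln 3 + ln (real k)"
        proof -
          have "ln (real (k + l + 1)) \<le> ln (3 * real k)" using l k1 by (subst ln_le_cancel_iff) auto
          then show ?thesis using k1 by (simp add: ln_mult_pos)
        qed
        moreover have "C + ln 3 + ln (real k) \<le> e * real k" using K[of k] k by simp
        moreover have "real k * F (real l / real k) = G (real l / real k) * real k + real k * F0 (real l / real k)"
          by (simp add: F_eq algebra_simps)
        ultimately show ?thesis unfolding g_def by linarith
      qed
      then have "h k \<le> 2 * e * real k"
        using e k1 unfolding h_def by (intro Max.boundedI) auto
      then have "h k / real k \<le> 2 * e" using k1 by (simp add: divide_le_eq)
      moreover have "0 \<le> h k / real k" using h(1)[of k] by simp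
      moreover have "2 * e < r" using r by (simp add: e_def)
      ultimately show ?thesis by simp
    qed
    then show "\<exists>no. \<forall>k\<ge>no. norm (h k / real k - 0) < r" by blast
  qed
  ultimately show ?thesis by blast
qed

end
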